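(* Let $n\geqslant 1$ and let $G$ be a simple connected graph on $n$ vertices. Then $$\frac{F(G)}{T(G)}\geqslant \frac{F(K_n)}{T(K_n)},$$ and equality holds if and only if $G=K_n$ (i.e. $G$ is the complete graph on its $n$ vertices).
   Context: All graphs are finite. For a connected graph $G=(V,E)$, $F(G)$ denotes the number of spanning forests of $G$, that is, the number of edge subsets $A\subseteq E$ containing no cycle (the empty set included), and $T(G)$ denotes the number of spanning trees of $G$. $K_n$ is the complete graph on $n$ vertices. *)

theory Defs
  imports Complex_Main
begin

type_synonym 'a graph = "'a set \<times> 'a set set"

abbreviation vertices :: "'a graph \<Rightarrow> 'a set" where
  "vertices G \<equiv> fst G"

abbreviation edges :: "'a graph \<Rightarrow> 'a set set" where
  "edges G \<equiv> snd G"

definition simple_graph :: "'a graph \<Rightarrow> bool" where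
  "simple_graph G \<longleftrightarrow> finite (vertices G) \<and> (\<forall>e\<in>edges G. e \<subseteq> vertices G \<and> card e = 2)"

definition adjacency :: "'a set set \<Rightarrow> ('a \<times> 'a) set" where
  "adjacency A = {(u, v). {u, v} \<in> A}"

definition connected_graph :: "'a graph \<Rightarrow> bool" where
  "connected_graph G \<longleftrightarrow> vertices G \<noteq> {} \<and>
     (\<forall>u\<in>vertices G. \<forall>v\<in>vertices G. (u, v) \<in> (adjacency (edges G))\<^sup>*)"

text \<open>A cycle is given by its vertices in cyclic order, without repeating the first vertex
  at the end; the index is taken modulo the length to obtain the closing edge.
  The bound 3 excludes traversing a single edge back and forth.\<close>

definition cycle_in :: "'a set set \<Rightarrow> 'a list \<Rightarrow> bool" where
  "cycle_in A vs \<longleftrightarrow> length vs \<ge> 3 \<and> distinct vs \<and>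
     (\<forall>i < length vs. {vs ! i, vs ! (Suc i mod length vs)} \<in> A)"

definition cycle_free :: "'a set set \<Rightarrow> bool" where
  "cycle_free A \<longleftrightarrow> \<not> (\<exists>vs. cycle_in A vs)"

definition spanning_forests :: "'a graph \<Rightarrow> 'a set set set" where
  "spanning_forests G = {A. A \<subseteq> edges G \<and> cycle_free A}"

definition spanning_trees :: "'a graph \<Rightarrow> 'a set set set" where
  "spanning_trees G = {A. A \<subseteq> edges G \<and> connected_graph (vertices G, A) \<and> cycle_free A}"

definition num_spanning_forests :: "'a graph \<Rightarrow> nat" where
  "num_spanning_forests G = card (spanning_forests G)"

definition num_spanning_trees :: "'a graph \<Rightarrow> nat" where
  "num_spanning_trees G = card (spanning_trees G)"

definition complete_graph :: "'a set \<Rightarrow> 'a graph" where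
  "complete_graph V = (V, {e. e \<subseteq> V \<and> card e = 2})"

definition K_graph :: "nat \<Rightarrow> nat graph" where
  "K_graph n = complete_graph {..<n}"

end

theory Submission
  imports Defs
begin

text \<open>
  Let \<open>N\<^sub>k\<close> be the number of spanning forests with \<open>k\<close> components and \<open>S\<^sub>k\<close> the sum, over these forests,
  of the squares of the component sizes. Two linear inequalities hold on a graph with \<open>n\<close> vertices,
  both with equality on the complete graph:
  \<open>n\<^sup>2 N\<^sub>k - S\<^sub>k \<ge> 2 (n - k + 1) N\<^sub>k\<^sub>-\<^sub>1\<close> and \<open>(2 k - 1) S\<^sub>k - n\<^sup>2 N\<^sub>k \<ge> S\<^sub>k\<^sub>-\<^sub>1 - n N\<^sub>k\<^sub>-\<^sub>1\<close>.
  The first counts pairs of a forest and one of its edges: two components of sizes \<open>c\<close> and \<open>d\<close> are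
  joined by at most \<open>c d\<close> edges. The second reduces, by looking at a pair of components, to the
  inequality \<open>\<Sum> (c\<^sup>2 - c d + d\<^sup>2) \<ge> n (n - 1) / 2 \<cdot> T\<close> over the forests with two components.
  If \<open>P\<close> is the pseudo-inverse of the Laplacian, then the number of these forests is
  \<open>T (1 + 2 / n) tr P - T / 2 \<cdot> \<Sum> (P\<^sub>x\<^sub>x P\<^sub>y\<^sub>y - P\<^sub>x\<^sub>y\<^sup>2)\<close>, summed over ordered adjacent pairs, because
  each component \<open>D\<close> satisfies \<open>1 = |D| - e(D)\<close> and forests with three components separating given
  vertices are counted by \<open>2 \<times> 2\<close> minors. The inequality then follows from \<open>2 a b \<le> a\<^sup>2 + b\<^sup>2\<close> and
  \<open>\<Sum>\<^sub>y (P\<^sub>x\<^sub>x - P\<^sub>x\<^sub>y - 1 / n)\<^sup>2 \<ge> 0\<close>. Combining the two inequalities with nonnegative multipliers, from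
  \<open>k = n\<close> down to \<open>k = 2\<close>, bounds the number of forests below by a constant multiple of \<open>T\<close>, and the
  constant is the ratio for the complete graph since all steps are equalities there.
\<close>

section \<open>Sums over subsets\<close>

lemma sum_Pow_compl:
  assumes "finite M"
  shows "(\<Sum>C\<in>Pow M. \<phi> (M - C)) = (\<Sum>C\<in>Pow M. \<phi> C)"
  by (rule sum.reindex_bij_witness[where i="\<lambda>C. M - C" and j="\<lambda>C. M - C"]) (auto simp: double_diff)

text \<open>A pair of disjoint subsets \<open>A\<close>, \<open>B\<close> of \<open>M\<close> is the
  same as their union \<open>D\<close> together with \<open>A\<close>. Read in either direction,
  this splits a component in two or merges two components.\<close>

lemma sum_Pow_Pow:
  fixes \<phi> :: "'a set \<Rightarrow> 'a set \<Rightarrow> 'b::comm_monoid_add"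
  assumes "finite M"
  shows "(\<Sum>D\<in>Pow M. \<Sum>A\<in>Pow D. \<phi> A (D - A)) = (\<Sum>A\<in>Pow M. \<Sum>B\<in>Pow (M - A). \<phi> A B)"
proof -
  have fin: "finite A" if "A \<in> Pow M" for A
    using assms that finite_subset by auto
  have "(\<Sum>D\<in>Pow M. \<Sum>A\<in>Pow D. \<phi> A (D - A)) = (\<Sum>(D, A)\<in>Sigma (Pow M) Pow. \<phi> A (D - A))"
    by (rule sum.Sigma) (use assms fin in auto)
  also have "\<dots> = (\<Sum>(A, B)\<in>Sigma (Pow M) (\<lambda>A. Pow (M - A)). \<phi> A B)"
    by (rule sum.reindex_bij_witness[where i="\<lambda>(A, B). (A \<union> B, A)" and j="\<lambda>(D, A). (A, D - A)"]) auto
  also have "\<dots> = (\<Sum>A\<in>Pow M. \<Sum>B\<in>Pow (M - A). \<phi> A B)"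
    by (rule sum.Sigma[symmetric]) (use assms fin in auto)
  finally show ?thesis .
qed

lemma sum_Pow_swap:
  fixes \<phi> :: "'a set \<Rightarrow> 'a set \<Rightarrow> 'b::comm_monoid_add"
  assumes "finite M"
  shows "(\<Sum>A\<in>Pow M. \<Sum>B\<in>Pow (M - A). \<phi> A B) = (\<Sum>B\<in>Pow M. \<Sum>A\<in>Pow (M - B). \<phi> A B)"
proof -
  have fin: "finite A" if "A \<in> Pow M" for A
    using assms that finite_subset by auto
  have "(\<Sum>A\<in>Pow M. \<Sum>B\<in>Pow (M - A). \<phi> A B) = (\<Sum>(A, B)\<in>Sigma (Pow M) (\<lambda>A. Pow (M - A)). \<phi> A B)"
    by (rule sum.Sigma) (use assms fin in auto)
  also have "\<dots> = (\<Sum>(B, A)\<in>Sigma (Pow M) (\<lambda>A. Pow (M - A)). \<phi> A B)"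
    by (rule sum.reindex_bij_witness[where i="\<lambda>(A, B). (B, A)" and j="\<lambda>(A, B). (B, A)"]) auto
  also have "\<dots> = (\<Sum>B\<in>Pow M. \<Sum>A\<in>Pow (M - B). \<phi> A B)"
    by (rule sum.Sigma[symmetric]) (use assms fin in auto)
  finally show ?thesis .
qed

lemma sum_of_bool_mem:
  fixes f :: "'a \<Rightarrow> real"
  assumes "finite M" "C \<subseteq> M"
  shows "(\<Sum>w\<in>M. of_bool (w \<in> C) * f w) = (\<Sum>w\<in>C. f w)"
  using assms by (simp add: sum.inter_restrict of_bool_def if_distrib [of "\<lambda>u. u * _"] Int_absorb1 cong: if_cong)
    (metis sum.inter_restrict Int_absorb1)

lemma set_Diff_commute: "A - B - C = A - C - (B :: 'a set)"
  by auto

section \<open>Green functions of tree counts\<close>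

text \<open>
  \<open>t M\<close> stands for the number of spanning trees on the vertex set \<open>M\<close>. In \<open>t_branch\<close> the edge at \<open>x\<close>
  that leads towards \<open>z\<close> is removed, and \<open>B\<close> is the side of \<open>z\<close>; nothing else is used about trees.
\<close>

locale tree_weights =
  fixes a :: "'a \<Rightarrow> 'a \<Rightarrow> real" and t :: "'a set \<Rightarrow> real"
  assumes a_sym: "a x y = a y x"
    and a_nonneg: "0 \<le> a x y"
    and a_le_1: "a x y \<le> 1"
    and a_irrefl: "a x x = 0"
    and t_nonneg: "0 \<le> t M"
    and t_empty: "t {} = 0"
    and t_sing: "t {v} = 1"
    and t_branch: "\<lbrakk>finite M; x \<in> M; z \<in> M; x \<noteq> z\<rbrakk> \<Longrightarrow>
      t M = (\<Sum>B\<in>Pow M. of_bool (z \<in> B \<and> x \<notin> B) * ((\<Sum>w\<in>B. a x w) * t B * t (M - B)))"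
begin

section \<open>The Laplacian and its Green function with one root\<close>

definition deg :: "'a \<Rightarrow> 'a set \<Rightarrow> real" where
  "deg x S = (\<Sum>w\<in>S. a x w)"

text \<open>
  Counts the forests with components \<open>C\<close> and \<open>M - C\<close> that separate \<open>r\<close> from \<open>x\<close> and \<open>z\<close>; divided by \<open>t M\<close>
  it is the inverse of the Laplacian with row and column \<open>r\<close> deleted.
\<close>

definition green :: "'a set \<Rightarrow> 'a \<Rightarrow> 'a \<Rightarrow> 'a \<Rightarrow> real" where
  "green M r x z = (\<Sum>C\<in>Pow M. of_bool (x \<in> C) * of_bool (z \<in> C) * of_bool (r \<notin> C) * (t C * t (M - C)))"

definition lap :: "'a set \<Rightarrow> ('a \<Rightarrow> real) \<Rightarrow> 'a \<Rightarrow> real" where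
  "lap M \<phi> x = (\<Sum>w\<in>M. a x w * (\<phi> x - \<phi> w))"

lemma deg_split:
  assumes "finite M" "C \<subseteq> M"
  shows "(\<Sum>w\<in>M. a x w * (of_bool (x \<in> C) - of_bool (w \<in> C)))
    = of_bool (x \<in> C) * deg x (M - C) - of_bool (x \<notin> C) * deg x C"
proof -
  have "(\<Sum>w\<in>M. a x w) = deg x (M - C) + deg x C"
    unfolding deg_def using sum.subset_diff[OF assms(2,1)] by blast
  moreover have "(\<Sum>w\<in>M. a x w * of_bool (w \<in> C)) = deg x C"
    unfolding deg_def using sum_of_bool_mem[OF assms, of "a x"] by (simp add: mult.commute)
  ultimately show ?thesis
    by (simp add: algebra_simps sum_subtractf sum_distrib_left[symmetric])
qed

lemma t_branch': 
  assumes "finite M" "x \<in> M" "z \<in> M" "x \<noteq> z"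
  shows "t M = (\<Sum>B\<in>Pow M. of_bool (z \<in> B) * of_bool (x \<notin> B) * (deg x B * t B * t (M - B)))"
  using t_branch[OF assms] by (simp add: deg_def of_bool_conj)

text \<open>The same edge removal, indexed by the side \<open>D\<close> of \<open>x\<close> instead
  of the side of the target \<open>r\<close>.\<close>

lemma t_branch_compl:
  assumes "finite M" "x \<in> M" "r \<in> M" "x \<noteq> r"
  shows "t M = (\<Sum>D\<in>Pow M. of_bool (x \<in> D) * of_bool (r \<notin> D) * (deg x (M - D) * t D * t (M - D)))"
proof -
  have "t M = (\<Sum>B\<in>Pow M. of_bool (r \<in> B) * of_bool (x \<notin> B) * (deg x B * t B * t (M - B)))"
    by (rule t_branch') (use assms in auto)
  also have "\<dots> = (\<Sum>D\<in>Pow M. of_bool (r \<in> M - D) * of_bool (x \<notin> M - D) * (deg x (M - D) * t (M - D) * t (M - (M - D))))"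
    by (rule sum_Pow_compl[OF assms(1), symmetric])
  also have "\<dots> = (\<Sum>D\<in>Pow M. of_bool (x \<in> D) * of_bool (r \<notin> D) * (deg x (M - D) * t D * t (M - D)))"
    by (rule sum.cong) (use assms in \<open>auto simp: double_diff\<close>)
  finally show ?thesis .
qed

text \<open>The Laplacian of the indicator of \<open>C\<close> counts, with sign, the edges at
  \<open>x\<close> across the boundary of \<open>C\<close>. For \<open>x = z\<close>, joining
  \<open>C\<close> to its complement by an edge at \<open>x\<close> builds every tree on
  \<open>M\<close>. For \<open>x \<noteq> z\<close> the two signs cancel: the branch at
  \<open>x\<close> that contains \<open>z\<close> is cut off, and the rest is joined at
  \<open>x\<close> to the component of \<open>r\<close>.\<close>

lemma lap_green:
  assumes M: "finite M" and x: "x \<in> M" and r: "r \<in> M" and xr: "x \<noteq> r"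
  shows "lap M (\<lambda>x. green M r x z) x = of_bool (x = z) * t M"
proof -
  define K where "K C = of_bool (z \<in> C) * of_bool (r \<notin> C) * (t C * t (M - C))" for C
  have fin: "finite (Pow M)" using M by simp
  have "lap M (\<lambda>x. green M r x z) x
      = (\<Sum>w\<in>M. \<Sum>C\<in>Pow M. K C * (a x w * (of_bool (x \<in> C) - of_bool (w \<in> C))))"
    unfolding lap_def green_def K_def
    by (auto simp: sum_subtractf[symmetric] sum_distrib_left algebra_simps intro!: sum.cong)
  also have "\<dots> = (\<Sum>C\<in>Pow M. K C * (\<Sum>w\<in>M. a x w * (of_bool (x \<in> C) - of_bool (w \<in> C))))"
    by (subst sum.swap) (simp add: sum_distrib_left)
  also have "\<dots> = (\<Sum>C\<in>Pow M. K C * (of_bool (x \<in> C) * deg x (M - C) - of_bool (x \<notin> C) * deg x C))"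
    by (intro sum.cong refl arg_cong2[where f="(*)"] deg_split) (use M in auto)
  also have "\<dots> = (\<Sum>C\<in>Pow M. of_bool (x \<in> C) * K C * deg x (M - C)) - (\<Sum>C\<in>Pow M. of_bool (x \<notin> C) * K C * deg x C)"
    by (simp add: sum_subtractf[symmetric] algebra_simps)
  also have "\<dots> = of_bool (x = z) * t M"
  proof (cases "x = z")
    case True
    have "(\<Sum>C\<in>Pow M. of_bool (x \<notin> C) * K C * deg x C) = 0"
      by (rule sum.neutral) (simp add: K_def True)
    moreover have "(\<Sum>C\<in>Pow M. of_bool (x \<in> C) * K C * deg x (M - C)) = t M"
      unfolding t_branch_compl[OF M x r xr]
      by (rule sum.cong) (auto simp: K_def True algebra_simps)
    ultimately show ?thesis using True by simp
  next
    case False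
    \<comment> \<open>The tree on \<open>C\<close> is cut at its edge from \<open>x\<close> towards
      \<open>z\<close>; \<open>B\<close> is the part containing \<open>z\<close>.\<close>
    have "(\<Sum>C\<in>Pow M. of_bool (x \<in> C) * K C * deg x (M - C))
        = (\<Sum>C\<in>Pow M. \<Sum>B\<in>Pow C. of_bool (z \<in> B) * of_bool (x \<notin> B) * (deg x B * t B * t (C - B)) *
             (of_bool (x \<in> C - B) * of_bool (r \<notin> B) * of_bool (r \<notin> C - B) * t (M - B - (C - B)) * deg x (M - B - (C - B))))"
      (is "_ = (\<Sum>C\<in>Pow M. ?I C)")
    proof (rule sum.cong[OF refl])
      fix C assume C: "C \<in> Pow M"
      show "of_bool (x \<in> C) * K C * deg x (M - C) = ?I C"
      proof (cases "x \<in> C \<and> z \<in> C")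
        case True
        have "finite C" using C M finite_subset by auto
        then have tC: "t C = (\<Sum>B\<in>Pow C. of_bool (z \<in> B) * of_bool (x \<notin> B) * (deg x B * t B * t (C - B)))"
          using t_branch'[of C x z] True False by auto
        have "of_bool (x \<in> C) * K C * deg x (M - C) = t C * (of_bool (r \<notin> C) * t (M - C) * deg x (M - C))"
          using True by (simp add: K_def)
        also have "\<dots> = ?I C"
          unfolding tC sum_distrib_right
        proof (rule sum.cong[OF refl])
          fix B assume B: "B \<in> Pow C"
          have "M - B - (C - B) = M - C" using B by auto
          then show "of_bool (z \<in> B) * of_bool (x \<notin> B) * (deg x B * t B * t (C - B)) * (of_bool (r \<notin> C) * t (M - C) * deg x (M - C))
            = of_bool (z \<in> B) * of_bool (x \<notin> B) * (deg x B * t B * t (C - B)) *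
             (of_bool (x \<in> C - B) * of_bool (r \<notin> B) * of_bool (r \<notin> C - B) * t (M - B - (C - B)) * deg x (M - B - (C - B)))"
            using B True by auto
        qed
        finally show ?thesis .
      next
        case F: False
        have "?I C = 0"
          by (rule sum.neutral) (use F in auto)
        then show ?thesis using F by (auto simp: K_def)
      qed
    qed
    also have "\<dots> = (\<Sum>B\<in>Pow M. \<Sum>D\<in>Pow (M - B). of_bool (z \<in> B) * of_bool (x \<notin> B) * (deg x B * t B * t D) *
             (of_bool (x \<in> D) * of_bool (r \<notin> B) * of_bool (r \<notin> D) * t (M - B - D) * deg x (M - B - D)))"
      by (rule sum_Pow_Pow[OF M])
    \<comment> \<open>With \<open>B\<close> fixed, the part \<open>D\<close> of \<open>x\<close> and
      the component of \<open>r\<close> are joined by an edge at \<open>x\<close> and run through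
      all trees on \<open>M - B\<close>.\<close>
    also have "\<dots> = (\<Sum>B\<in>Pow M. of_bool (x \<notin> B) * K B * deg x B)"
    proof (rule sum.cong[OF refl])
      fix B assume B: "B \<in> Pow M"
      show "(\<Sum>D\<in>Pow (M - B). of_bool (z \<in> B) * of_bool (x \<notin> B) * (deg x B * t B * t D) *
             (of_bool (x \<in> D) * of_bool (r \<notin> B) * of_bool (r \<notin> D) * t (M - B - D) * deg x (M - B - D)))
          = of_bool (x \<notin> B) * K B * deg x B"
      proof (cases "x \<notin> B \<and> r \<notin> B")
        case True
        then have "t (M - B) = (\<Sum>D\<in>Pow (M - B). of_bool (x \<in> D) * of_bool (r \<notin> D) * (deg x (M - B - D) * t D * t (M - B - D)))"
          using t_branch_compl[of "M - B" x r] M x r xr by auto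
        then have "of_bool (x \<notin> B) * K B * deg x B = of_bool (z \<in> B) * t B * deg x B *
            (\<Sum>D\<in>Pow (M - B). of_bool (x \<in> D) * of_bool (r \<notin> D) * (deg x (M - B - D) * t D * t (M - B - D)))"
          using True by (simp add: K_def)
        then show ?thesis
          using True by (simp add: sum_distrib_left algebra_simps)
      qed (auto simp: K_def)
    qed
    finally show ?thesis using False by simp
  qed
  finally show ?thesis .
qed

lemma lap_self_adjoint: "(\<Sum>x\<in>M. \<phi> x * lap M \<psi> x) = (\<Sum>x\<in>M. \<psi> x * lap M \<phi> x)"
proof -
  have "(\<Sum>x\<in>M. \<Sum>w\<in>M. a x w * (\<phi> x * \<psi> w)) = (\<Sum>x\<in>M. \<Sum>w\<in>M. a x w * (\<phi> w * \<psi> x))"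
    by (subst sum.swap) (simp add: a_sym)
  then show ?thesis
    by (simp add: lap_def sum_distrib_left algebra_simps sum_subtractf)
qed

lemma green_root [simp]: "green M r r z = 0" "green M r x r = 0"
  by (auto simp: green_def intro!: sum.neutral)

lemma green_sym: "green M r x z = green M r z x"
  by (simp add: green_def mult.assoc mult.left_commute)

lemma green_nonneg: "0 \<le> green M r x z"
  unfolding green_def by (rule sum_nonneg) (simp add: t_nonneg)

section \<open>Forests with three components as 2 by 2 minors\<close>

text \<open>
  Counts the forests with three components, two of which contain \<open>r\<close> and \<open>y\<close>, and the third \<open>x\<close> and \<open>z\<close>.
\<close>

definition green2 :: "'a set \<Rightarrow> 'a \<Rightarrow> 'a \<Rightarrow> 'a \<Rightarrow> 'a \<Rightarrow> real" where
  "green2 M r y x z = (\<Sum>D\<in>Pow M. of_bool (x \<in> D) * of_bool (z \<in> D) * of_bool (r \<notin> D) * of_bool (y \<notin> D) *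
     (t D * green (M - D) r y y))"

text \<open>Makes the third component \<open>M - D - C\<close>, which contains \<open>r\<close>,
  visible, so that \<open>r\<close> and \<open>y\<close> can exchange their roles.\<close>

lemma green2_alt:
  assumes "finite M" "r \<in> M"
  shows "green2 M r y x z = (\<Sum>D\<in>Pow M. \<Sum>C\<in>Pow (M - D). of_bool (x \<in> D) * of_bool (z \<in> D) *
    of_bool (y \<in> C) * of_bool (r \<in> M - D - C) * (t D * t C * t (M - D - C)))"
  unfolding green2_def green_def sum_distrib_left
  by (intro sum.cong refl) (use assms in auto)

lemma sum_Pow_third:
  assumes "finite M"
  shows "(\<Sum>D\<in>Pow M. \<Sum>C\<in>Pow (M - D). \<phi> D C (M - D - C)) = (\<Sum>D\<in>Pow M. \<Sum>C\<in>Pow (M - D). \<phi> D (M - D - C) C)"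
proof (rule sum.cong[OF refl])
  fix D assume "D \<in> Pow M"
  have "finite (M - D)" using assms by simp
  from sum_Pow_compl[OF this, of "\<lambda>C. \<phi> D C (M - D - C)"]
  show "(\<Sum>C\<in>Pow (M - D). \<phi> D C (M - D - C)) = (\<Sum>C\<in>Pow (M - D). \<phi> D (M - D - C) C)"
    by (auto simp: double_diff intro!: sum.cong)
qed

text \<open>Collects the contributions of edges \<open>{x, w}\<close> with no end in the component
  \<open>C\<close> of \<open>y\<close>. With \<open>C\<close> fixed, the rest is a Green function on
  \<open>M - C\<close>, to which \<open>lap_green\<close> applies.\<close>

lemma lap_green2_part:
  assumes M: "finite M" and x: "x \<in> M" and r: "r \<in> M" and xr: "x \<noteq> r"
  shows "(\<Sum>D\<in>Pow M. \<Sum>C\<in>Pow (M - D). of_bool (z \<in> D) * of_bool (y \<in> C) * of_bool (r \<in> M - D - C) *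
       (t D * t C * t (M - D - C)) * (\<Sum>w\<in>M. a x w * ((of_bool (x \<in> D) - of_bool (w \<in> D)) * of_bool (x \<notin> C \<and> w \<notin> C))))
     = of_bool (x = z) * (\<Sum>C\<in>Pow M. of_bool (y \<in> C) * of_bool (r \<notin> C) * of_bool (x \<notin> C) * (t C * t (M - C)))"
    (is "?L = ?R")
proof -
  have "?L = (\<Sum>C\<in>Pow M. \<Sum>D\<in>Pow (M - C). of_bool (z \<in> D) * of_bool (y \<in> C) * of_bool (r \<in> M - D - C) *
       (t D * t C * t (M - D - C)) * (\<Sum>w\<in>M. a x w * ((of_bool (x \<in> D) - of_bool (w \<in> D)) * of_bool (x \<notin> C \<and> w \<notin> C))))"
    by (rule sum_Pow_swap[OF M])
  also have "\<dots> = (\<Sum>C\<in>Pow M. of_bool (y \<in> C) * of_bool (r \<notin> C) * of_bool (x \<notin> C) * t C * lap (M - C) (\<lambda>x. green (M - C) r x z) x)"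
  proof (rule sum.cong[OF refl])
    fix C assume C: "C \<in> Pow M"
    have w: "(\<Sum>w\<in>M. a x w * ((of_bool (x \<in> D) - of_bool (w \<in> D)) * of_bool (x \<notin> C \<and> w \<notin> C)))
      = of_bool (x \<notin> C) * (\<Sum>w\<in>M - C. a x w * (of_bool (x \<in> D) - of_bool (w \<in> D)))" for D
      unfolding sum_distrib_left
      by (rule sum.mono_neutral_cong_right) (use M in auto)
    have "lap (M - C) (\<lambda>x. green (M - C) r x z) x
      = (\<Sum>w\<in>M - C. \<Sum>D\<in>Pow (M - C). of_bool (z \<in> D) * of_bool (r \<notin> D) * (t D * t (M - C - D)) * (a x w * (of_bool (x \<in> D) - of_bool (w \<in> D))))"
      unfolding lap_def green_def
      by (auto simp: sum_subtractf[symmetric] sum_distrib_left algebra_simps intro!: sum.cong)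
    also have "\<dots> = (\<Sum>D\<in>Pow (M - C). of_bool (z \<in> D) * of_bool (r \<notin> D) * (t D * t (M - C - D)) * (\<Sum>w\<in>M - C. a x w * (of_bool (x \<in> D) - of_bool (w \<in> D))))"
      by (subst sum.swap) (simp add: sum_distrib_left)
    finally have L: "lap (M - C) (\<lambda>x. green (M - C) r x z) x = \<dots>" .
    have eq: "M - D - C = M - C - D" for D by auto
    show "(\<Sum>D\<in>Pow (M - C). of_bool (z \<in> D) * of_bool (y \<in> C) * of_bool (r \<in> M - D - C) *
       (t D * t C * t (M - D - C)) * (\<Sum>w\<in>M. a x w * ((of_bool (x \<in> D) - of_bool (w \<in> D)) * of_bool (x \<notin> C \<and> w \<notin> C))))
      = of_bool (y \<in> C) * of_bool (r \<notin> C) * of_bool (x \<notin> C) * t C * lap (M - C) (\<lambda>x. green (M - C) r x z) x"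
      unfolding L w sum_distrib_left eq
      by (intro sum.cong refl) (use r in auto)
  qed
  also have "\<dots> = ?R"
    unfolding sum_distrib_left
  proof (rule sum.cong[OF refl])
    fix C assume C: "C \<in> Pow M"
    show "of_bool (y \<in> C) * of_bool (r \<notin> C) * of_bool (x \<notin> C) * t C * lap (M - C) (\<lambda>x. green (M - C) r x z) x
      = of_bool (x = z) * (of_bool (y \<in> C) * of_bool (r \<notin> C) * of_bool (x \<notin> C) * (t C * t (M - C)))"
    proof (cases "r \<notin> C \<and> x \<notin> C")
      case True
      then show ?thesis using lap_green[of "M - C" x r z] M x r xr by auto
    qed auto
  qed
  finally show ?thesis .
qed

lemma lap_green2:
  assumes M: "finite M" and x: "x \<in> M" and r: "r \<in> M" and y: "y \<in> M" and ry: "r \<noteq> y" and xr: "x \<noteq> r" and xy: "x \<noteq> y"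
  shows "lap M (\<lambda>x. green2 M r y x z) x = of_bool (x = z) * green M r y y"
proof -
  define K where "K D C E = of_bool (z \<in> D) * of_bool (y \<in> C) * of_bool (r \<in> E) * (t D * t C * t E)" for D C E
  have "lap M (\<lambda>x. green2 M r y x z) x = (\<Sum>w\<in>M. \<Sum>D\<in>Pow M. \<Sum>C\<in>Pow (M - D). K D C (M - D - C) * (a x w * (of_bool (x \<in> D) - of_bool (w \<in> D))))"
    unfolding lap_def green2_alt[OF M r] K_def
    by (auto simp: sum_subtractf[symmetric] sum_distrib_left algebra_simps intro!: sum.cong)
  also have "\<dots> = (\<Sum>D\<in>Pow M. \<Sum>w\<in>M. \<Sum>C\<in>Pow (M - D). K D C (M - D - C) * (a x w * (of_bool (x \<in> D) - of_bool (w \<in> D))))"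
    by (rule sum.swap)
  also have "\<dots> = (\<Sum>D\<in>Pow M. \<Sum>C\<in>Pow (M - D). K D C (M - D - C) * (\<Sum>w\<in>M. a x w * (of_bool (x \<in> D) - of_bool (w \<in> D))))"
    by (intro sum.cong refl, subst sum.swap) (simp add: sum_distrib_left)
  \<comment> \<open>If exactly one of \<open>x\<close> and \<open>w\<close> lies in
    \<open>D\<close>, the other lies in exactly one of the two remaining components, so the edge
    avoids exactly one of them.\<close>
  also have "\<dots> = (\<Sum>D\<in>Pow M. \<Sum>C\<in>Pow (M - D). K D C (M - D - C) * (\<Sum>w\<in>M. a x w * ((of_bool (x \<in> D) - of_bool (w \<in> D)) * of_bool (x \<notin> C \<and> w \<notin> C))))
     + (\<Sum>D\<in>Pow M. \<Sum>C\<in>Pow (M - D). K D C (M - D - C) * (\<Sum>w\<in>M. a x w * ((of_bool (x \<in> D) - of_bool (w \<in> D)) * of_bool (x \<notin> M - D - C \<and> w \<notin> M - D - C))))"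
    (is "_ = ?A + ?B")
    unfolding sum.distrib[symmetric] distrib_left[symmetric]
    by (intro sum.cong refl arg_cong2[where f="(*)"]) (use x in auto)
  also have "?B = (\<Sum>D\<in>Pow M. \<Sum>C\<in>Pow (M - D). K D (M - D - C) C * (\<Sum>w\<in>M. a x w * ((of_bool (x \<in> D) - of_bool (w \<in> D)) * of_bool (x \<notin> C \<and> w \<notin> C))))"
    using sum_Pow_third[OF M, of "\<lambda>D C E. K D C E * (\<Sum>w\<in>M. a x w * ((of_bool (x \<in> D) - of_bool (w \<in> D)) * of_bool (x \<notin> E \<and> w \<notin> E)))"]
    by simp
  also have "\<dots> = of_bool (x = z) * (\<Sum>C\<in>Pow M. of_bool (r \<in> C) * of_bool (y \<notin> C) * of_bool (x \<notin> C) * (t C * t (M - C)))"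
    unfolding lap_green2_part[OF M x y xy, symmetric] K_def
    by (intro sum.cong refl) (simp only: mult_ac)
  \<comment> \<open>Complementation turns this sum into the part \<open>x \<in> C\<close> of
    \<open>green M r y y\<close>; the part \<open>x \<notin> C\<close> comes from
    \<open>?A\<close>.\<close>
  also have "(\<Sum>C\<in>Pow M. of_bool (r \<in> C) * of_bool (y \<notin> C) * of_bool (x \<notin> C) * (t C * t (M - C)))
      = (\<Sum>C\<in>Pow M. of_bool (y \<in> C) * of_bool (r \<notin> C) * of_bool (x \<in> C) * (t C * t (M - C)))"
    by (subst sum_Pow_compl[OF M, symmetric]) (use r y x in \<open>auto simp: double_diff intro!: sum.cong\<close>)
  also have "?A = of_bool (x = z) * (\<Sum>C\<in>Pow M. of_bool (y \<in> C) * of_bool (r \<notin> C) * of_bool (x \<notin> C) * (t C * t (M - C)))"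
    unfolding lap_green2_part[OF M x r xr, symmetric] K_def ..
  finally show ?thesis
    unfolding green_def distrib_left[symmetric] sum.distrib[symmetric]
    by (auto intro!: sum.cong)
qed

text \<open>The terms of \<open>t_branch_compl\<close> contain the same products
  \<open>t C * t (M - C)\<close>, so a vanishing Green function would force
  \<open>t M = 0\<close>.\<close>

lemma green_pos:
  assumes M: "finite M" and y: "y \<in> M" and r: "r \<in> M" and ry: "r \<noteq> y" and T: "t M > 0"
  shows "green M r y y > 0"
proof (rule ccontr)
  assume "\<not> ?thesis"
  then have "green M r y y = 0" using green_nonneg[of M r y y] by simp
  then have z: "of_bool (y \<in> C) * of_bool (y \<in> C) * of_bool (r \<notin> C) * (t C * t (M - C)) = 0" if "C \<in> Pow M" for C
    unfolding green_def
    using M that by (subst (asm) sum_nonneg_eq_0_iff) (auto simp: t_nonneg)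
  have "t M = 0"
    unfolding t_branch_compl[OF M y r ry[symmetric]]
    by (rule sum.neutral) (use z in auto)
  then show False using T by simp
qed

text \<open>Both sides solve the same Dirichlet problem with boundary \<open>{r, y}\<close>.\<close>

lemma green2_eq:
  assumes M: "finite M" and r: "r \<in> M" and y: "y \<in> M" and ry: "r \<noteq> y" and z: "z \<in> M" and x: "x \<in> M" and T: "t M > 0"
  shows "t M * green2 M r y x z = green M r x z * green M r y y - green M r x y * green M r y z"
proof -
  define \<psi> where "\<psi> x = green2 M r y x z" for x
  have \<psi>0: "\<psi> r = 0" "\<psi> y = 0"
    by (auto simp: \<psi>_def green2_def intro!: sum.neutral)
  \<comment> \<open>Self-adjointness pairs \<open>\<psi>\<close> with the Green function at
    \<open>u\<close>. The Laplacian of \<open>\<psi>\<close> is known off \<open>r\<close> and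
    \<open>y\<close>, and \<open>r\<close> drops out because the Green function vanishes there; only
    the value at \<open>y\<close> remains unknown.\<close>
  have key: "t M * \<psi> u = green M r u z * (of_bool (z \<noteq> y) * green M r y y) + green M r u y * lap M \<psi> y"
    if u: "u \<in> M" for u
  proof -
    have "(\<Sum>v\<in>M. \<psi> v * lap M (\<lambda>v. green M r v u) v) = (\<Sum>v\<in>M. if v = u then \<psi> u * t M else 0)"
    proof (rule sum.cong[OF refl])
      fix v assume "v \<in> M"
      then show "\<psi> v * lap M (\<lambda>v. green M r v u) v = (if v = u then \<psi> u * t M else 0)"
        using lap_green[OF M _ r, of v u] \<psi>0 by (cases "v = r") auto
    qed
    then have "t M * \<psi> u = (\<Sum>v\<in>M. green M r v u * lap M \<psi> v)"
      using u M lap_self_adjoint[of \<psi> M "\<lambda>v. green M r v u"] by (simp add: mult.commute)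
    also have "\<dots> = (\<Sum>v\<in>M. (if v = z then green M r u z * (of_bool (z \<noteq> y) * green M r y y) else 0)
        + (if v = y then green M r u y * lap M \<psi> y else 0))"
    proof (rule sum.cong[OF refl])
      fix v assume v: "v \<in> M"
      show "green M r v u * lap M \<psi> v = (if v = z then green M r u z * (of_bool (z \<noteq> y) * green M r y y) else 0)
        + (if v = y then green M r u y * lap M \<psi> y else 0)"
      proof (cases "v = r \<or> v = y")
        case True
        then show ?thesis using ry by (auto simp: green_sym[of M r _ u])
      next
        case False
        then have "lap M \<psi> v = of_bool (v = z) * green M r y y"
          unfolding \<psi>_def using lap_green2[OF M v r y ry] by auto
        then show ?thesis using False by (auto simp: green_sym[of M r _ u])
      qed
    qed
    also have "\<dots> = green M r u z * (of_bool (z \<noteq> y) * green M r y y) + green M r u y * lap M \<psi> y"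
      using M z y by (simp add: sum.distrib)
    finally show ?thesis .
  qed
  have gy: "green M r y y > 0" by (rule green_pos[OF M y r ry T])
  \<comment> \<open>The boundary value \<open>\<psi> y = 0\<close> determines the unknown
    \<open>lap M \<psi> y\<close>.\<close>
  have "green M r y y * (green M r y z * of_bool (z \<noteq> y) + lap M \<psi> y) = 0"
    using key[OF y] \<psi>0 by (simp add: algebra_simps)
  then have "lap M \<psi> y = - green M r y z * of_bool (z \<noteq> y)"
    using gy by simp
  then show ?thesis
    using key[OF x] by (cases "z = y") (auto simp: \<psi>_def algebra_simps)
qed

section \<open>Forests with two components\<close>

definition cut :: "'a set \<Rightarrow> 'a set \<Rightarrow> real" where
  "cut A B = (\<Sum>x\<in>A. deg x B)"

lemma cut_sym: "cut A B = cut B A"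
  unfolding cut_def deg_def by (subst sum.swap) (simp add: a_sym)

text \<open>A tree on \<open>D\<close> has |D| - 1 edges, and each gives two ordered splits of
  \<open>D\<close>. To derive this from \<open>t_branch\<close> alone, that identity is summed over
  all ordered pairs \<open>x \<noteq> z\<close>, which gives a split the weight |B|; averaging with
  the complement replaces the weight by |D| / 2.\<close>

lemma t_edges:
  assumes D: "finite D"
  shows "2 * (real (card D) - 1) * t D = (\<Sum>B\<in>Pow D. t B * t (D - B) * cut B (D - B))"
proof (cases "D = {}")
  case True
  then show ?thesis by (simp add: t_empty)
next
  case False
  define m where "m = real (card D)"
  have m: "m > 0" using False D by (simp add: m_def card_gt_0_iff)
  define q where "q B = t B * t (D - B) * cut B (D - B)" for B
  have q_compl: "q (D - B) = q B" if "B \<in> Pow D" for B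
    using that by (auto simp: q_def double_diff cut_sym[of "D - B" B])
  have "m * (m - 1) * t D = (\<Sum>x\<in>D. \<Sum>z\<in>D. of_bool (x \<noteq> z) * t D)"
  proof -
    have "(\<Sum>z\<in>D. of_bool (x \<noteq> z) * t D) = (m - 1) * t D" if "x \<in> D" for x
    proof -
      have "(\<Sum>z\<in>D. of_bool (x \<noteq> z) * t D) = (\<Sum>z\<in>D. t D - (if z = x then t D else 0))"
        by (intro sum.cong refl) auto
      also have "\<dots> = m * t D - t D"
        using that D by (simp add: sum_subtractf m_def)
      finally show ?thesis by (simp add: algebra_simps)
    qed
    then show ?thesis by (simp add: m_def)
  qed
  also have "\<dots> = (\<Sum>x\<in>D. \<Sum>z\<in>D. \<Sum>B\<in>Pow D. of_bool (z \<in> B) * of_bool (x \<in> D - B) * (deg x B * (t B * t (D - B))))"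
  proof (intro sum.cong refl)
    fix x z assume xz: "x \<in> D" "z \<in> D"
    show "of_bool (x \<noteq> z) * t D = (\<Sum>B\<in>Pow D. of_bool (z \<in> B) * of_bool (x \<in> D - B) * (deg x B * (t B * t (D - B))))"
    proof (cases "x = z")
      case True
      then show ?thesis by (auto intro!: sum.neutral)
    next
      case False
      then have "t D = (\<Sum>B\<in>Pow D. of_bool (z \<in> B) * of_bool (x \<notin> B) * (deg x B * t B * t (D - B)))"
        by (intro t_branch' D xz)
      with False xz show ?thesis by (simp add: mult.assoc)
    qed
  qed
  also have "\<dots> = (\<Sum>x\<in>D. \<Sum>B\<in>Pow D. of_bool (x \<in> D - B) * (deg x B * (t B * t (D - B))) * (\<Sum>z\<in>D. of_bool (z \<in> B)))"
    by (rule sum.cong[OF refl], subst sum.swap) (simp add: sum_distrib_left mult_ac)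
  also have "\<dots> = (\<Sum>B\<in>Pow D. \<Sum>x\<in>D. of_bool (x \<in> D - B) * (deg x B * (t B * t (D - B)) * real (card B)))"
  proof (subst sum.swap, intro sum.cong refl)
    fix B x assume "B \<in> Pow D"
    then have "(\<Sum>z\<in>D. of_bool (z \<in> B)) = real (card B)"
      using sum_of_bool_mem[OF D, of B "\<lambda>_. 1"] by simp
    then show "of_bool (x \<in> D - B) * (deg x B * (t B * t (D - B))) * (\<Sum>z\<in>D. of_bool (z \<in> B)) =
      of_bool (x \<in> D - B) * (deg x B * (t B * t (D - B)) * real (card B))" by simp
  qed
  also have "\<dots> = (\<Sum>B\<in>Pow D. real (card B) * q B)"
  proof (intro sum.cong refl)
    fix B assume "B \<in> Pow D"
    have "(\<Sum>x\<in>D. of_bool (x \<in> D - B) * (deg x B * (t B * t (D - B)) * real (card B))) = (\<Sum>x\<in>D - B. deg x B * (t B * t (D - B)) * real (card B))"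
      by (rule sum_of_bool_mem) (use D in auto)
    also have "\<dots> = real (card B) * q B"
    proof -
      have "q B = t B * t (D - B) * cut (D - B) B"
        unfolding q_def by (subst cut_sym) (rule refl)
      then show ?thesis by (simp add: cut_def sum_distrib_left mult_ac)
    qed
    finally show "(\<Sum>x\<in>D. of_bool (x \<in> D - B) * (deg x B * (t B * t (D - B)) * real (card B))) = real (card B) * q B" .
  qed
  finally have 1: "m * (m - 1) * t D = (\<Sum>B\<in>Pow D. real (card B) * q B)" .
  have "(\<Sum>B\<in>Pow D. real (card B) * q B) = (\<Sum>B\<in>Pow D. real (card (D - B)) * q (D - B))"
    by (rule sum_Pow_compl[OF D, symmetric])
  also have "\<dots> = (\<Sum>B\<in>Pow D. (m - real (card B)) * q B)"
    by (intro sum.cong refl) (use D q_compl in \<open>auto simp: m_def card_Diff_subset finite_subset card_mono of_nat_diff\<close>)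
  finally have "2 * (m * (m - 1) * t D) = m * (\<Sum>B\<in>Pow D. q B)"
    using 1 by (simp add: algebra_simps sum_subtractf sum_distrib_left)
  then have "m * (2 * (m - 1) * t D) = m * (\<Sum>B\<in>Pow D. q B)" by (simp add: mult_ac)
  then show ?thesis using m by (simp add: m_def q_def)
qed

definition pairw :: "'a set \<Rightarrow> 'a set \<Rightarrow> real" where
  "pairw M C = t C * t (M - C)"

lemma pairw_compl: "C \<subseteq> M \<Longrightarrow> pairw M (M - C) = pairw M C"
  by (simp add: pairw_def double_diff mult.commute)

lemma pairw_nonneg: "0 \<le> pairw M C"
  by (simp add: pairw_def t_nonneg)

text \<open>An edge of the component \<open>D\<close> that avoids \<open>r\<close> is removed, using
  \<open>t_edges\<close>. Its ends \<open>x\<close> and \<open>y\<close> then lie in two components,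
  and \<open>r\<close> lies in the third.\<close>

lemma sum_green2:
  assumes M: "finite M" and r: "r \<in> M"
  shows "(\<Sum>D\<in>Pow M. of_bool (r \<notin> D) * (2 * (real (card D) - 1) * pairw M D)) = (\<Sum>x\<in>M. \<Sum>y\<in>M. a x y * green2 M r y x x)"
proof -
  have "(\<Sum>D\<in>Pow M. of_bool (r \<notin> D) * (2 * (real (card D) - 1) * pairw M D))
    = (\<Sum>D\<in>Pow M. \<Sum>A\<in>Pow D. of_bool (r \<notin> A) * of_bool (r \<notin> D - A) * t (M - A - (D - A)) * (t A * t (D - A) * cut A (D - A)))"
  proof (rule sum.cong[OF refl])
    fix D assume D: "D \<in> Pow M"
    then have fD: "finite D" using M finite_subset by auto
    have "of_bool (r \<notin> D) * (2 * (real (card D) - 1) * pairw M D) = of_bool (r \<notin> D) * t (M - D) * (2 * (real (card D) - 1) * t D)"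
      by (simp add: pairw_def)
    also have "\<dots> = of_bool (r \<notin> D) * t (M - D) * (\<Sum>A\<in>Pow D. t A * t (D - A) * cut A (D - A))"
      by (simp only: t_edges[OF fD])
    also have "\<dots> = (\<Sum>A\<in>Pow D. of_bool (r \<notin> A) * of_bool (r \<notin> D - A) * t (M - A - (D - A)) * (t A * t (D - A) * cut A (D - A)))"
      unfolding sum_distrib_left
    proof (rule sum.cong[OF refl])
      fix A assume A: "A \<in> Pow D"
      then have "M - A - (D - A) = M - D" by auto
      then show "of_bool (r \<notin> D) * t (M - D) * (t A * t (D - A) * cut A (D - A)) =
         of_bool (r \<notin> A) * of_bool (r \<notin> D - A) * t (M - A - (D - A)) * (t A * t (D - A) * cut A (D - A))"
        using A by auto
    qed
    finally show "of_bool (r \<notin> D) * (2 * (real (card D) - 1) * pairw M D) = \<dots>" .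
  qed
  also have "\<dots> = (\<Sum>A\<in>Pow M. \<Sum>B\<in>Pow (M - A). of_bool (r \<notin> A) * of_bool (r \<notin> B) * t (M - A - B) * (t A * t B * cut A B))"
    by (rule sum_Pow_Pow[OF M])
  also have "\<dots> = (\<Sum>A\<in>Pow M. \<Sum>B\<in>Pow (M - A). \<Sum>x\<in>M. \<Sum>y\<in>M. a x y * (of_bool (x \<in> A) * of_bool (x \<in> A) * of_bool (y \<in> B) * of_bool (r \<in> M - A - B) * (t A * t B * t (M - A - B))))"
  proof (intro sum.cong refl)
    fix A B assume A: "A \<in> Pow M" and B: "B \<in> Pow (M - A)"
    have "cut A B = (\<Sum>x\<in>A. \<Sum>y\<in>B. a x y)" by (simp add: cut_def deg_def)
    also have "\<dots> = (\<Sum>x\<in>A. \<Sum>y\<in>M. of_bool (y \<in> B) * a x y)"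
      by (intro sum.cong refl sum_of_bool_mem[symmetric] M) (use B in auto)
    also have "\<dots> = (\<Sum>x\<in>M. of_bool (x \<in> A) * (\<Sum>y\<in>M. of_bool (y \<in> B) * a x y))"
      by (intro sum_of_bool_mem[symmetric] M) (use A in auto)
    finally have "cut A B = (\<Sum>x\<in>M. \<Sum>y\<in>M. of_bool (x \<in> A) * of_bool (y \<in> B) * a x y)"
      by (simp add: sum_distrib_left mult_ac)
    then have "of_bool (r \<notin> A) * of_bool (r \<notin> B) * t (M - A - B) * (t A * t B * cut A B)
      = (\<Sum>x\<in>M. \<Sum>y\<in>M. (of_bool (r \<notin> A) * of_bool (r \<notin> B) * t (M - A - B) * (t A * t B)) * (of_bool (x \<in> A) * of_bool (y \<in> B) * a x y))"
      by (simp only: sum_distrib_left mult.assoc)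
    also have "\<dots> = (\<Sum>x\<in>M. \<Sum>y\<in>M. a x y * (of_bool (x \<in> A) * of_bool (x \<in> A) * of_bool (y \<in> B) * of_bool (r \<in> M - A - B) * (t A * t B * t (M - A - B))))"
      by (intro sum.cong refl) (use r in auto)
    finally show "of_bool (r \<notin> A) * of_bool (r \<notin> B) * t (M - A - B) * (t A * t B * cut A B) = \<dots>" .
  qed
  also have "\<dots> = (\<Sum>x\<in>M. \<Sum>y\<in>M. \<Sum>A\<in>Pow M. \<Sum>B\<in>Pow (M - A). a x y * (of_bool (x \<in> A) * of_bool (x \<in> A) * of_bool (y \<in> B) * of_bool (r \<in> M - A - B) * (t A * t B * t (M - A - B))))"
    (is "_ = ?R")
  proof -
    let ?f = "\<lambda>x y A B. a x y * (of_bool (x \<in> A) * of_bool (x \<in> A) * of_bool (y \<in> B) * of_bool (r \<in> M - A - B) * (t A * t B * t (M - A - B)))"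
    have "(\<Sum>A\<in>Pow M. \<Sum>B\<in>Pow (M - A). \<Sum>x\<in>M. \<Sum>y\<in>M. ?f x y A B) = (\<Sum>A\<in>Pow M. \<Sum>x\<in>M. \<Sum>B\<in>Pow (M - A). \<Sum>y\<in>M. ?f x y A B)"
      by (intro sum.cong refl sum.swap)
    also have "\<dots> = (\<Sum>x\<in>M. \<Sum>A\<in>Pow M. \<Sum>B\<in>Pow (M - A). \<Sum>y\<in>M. ?f x y A B)"
      by (rule sum.swap)
    also have "\<dots> = (\<Sum>x\<in>M. \<Sum>A\<in>Pow M. \<Sum>y\<in>M. \<Sum>B\<in>Pow (M - A). ?f x y A B)"
      by (intro sum.cong refl sum.swap)
    also have "\<dots> = ?R"
      by (intro sum.cong refl sum.swap)
    finally show ?thesis .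
  qed
  also have "\<dots> = (\<Sum>x\<in>M. \<Sum>y\<in>M. a x y * green2 M r y x x)"
    unfolding green2_alt[OF M r] sum_distrib_left ..
  finally show ?thesis .
qed

section \<open>The pseudo-inverse of the Laplacian\<close>

definition cent :: "'a set \<Rightarrow> 'a set \<Rightarrow> 'a \<Rightarrow> real" where
  "cent M C x = of_bool (x \<in> C) - real (card C) / real (card M)"

text \<open>The pseudo-inverse of the Laplacian, multiplied by \<open>t M\<close>.\<close>

definition pinv :: "'a set \<Rightarrow> 'a \<Rightarrow> 'a \<Rightarrow> real" where
  "pinv M x y = (\<Sum>C\<in>Pow M. pairw M C * (cent M C x * cent M C y)) / 2"

lemma pinv_sym: "pinv M x y = pinv M y x"
  by (simp add: pinv_def mult.commute)

lemma sum_cent: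
  assumes "finite M" "C \<subseteq> M"
  shows "(\<Sum>x\<in>M. cent M C x) = 0"
proof (cases "M = {}")
  case False
  have "(\<Sum>x\<in>M. of_bool (x \<in> C)) = real (card C)"
    using sum_of_bool_mem[OF assms, of "\<lambda>_. 1"] by simp
  then show ?thesis using False assms by (simp add: cent_def sum_subtractf)
qed simp

lemma sum_pinv:
  assumes "finite M"
  shows "(\<Sum>y\<in>M. pinv M x y) = 0"
proof -
  have "(\<Sum>y\<in>M. pinv M x y) = (\<Sum>C\<in>Pow M. pairw M C * (cent M C x * (\<Sum>y\<in>M. cent M C y))) / 2"
    unfolding pinv_def sum_divide_distrib[symmetric] sum_distrib_left
    by (subst sum.swap) simp
  also have "\<dots> = 0" using sum_cent[OF assms] by simp
  finally show ?thesis .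
qed

text \<open>The means in \<open>cent\<close> cancel in the differences. The remaining product of
  differences of indicators is nonzero only if \<open>C\<close> separates \<open>r\<close> from both
  \<open>x\<close> and \<open>z\<close>; \<open>C\<close> and its complement contribute equally,
  which absorbs the division by 2.\<close>

lemma green_pinv:
  assumes M: "finite M" and "x \<in> M" "z \<in> M" "r \<in> M"
  shows "green M r x z = pinv M x z - pinv M x r - pinv M r z + pinv M r r"
proof -
  have "pinv M x z - pinv M x r - pinv M r z + pinv M r r
    = (\<Sum>C\<in>Pow M. pairw M C * ((of_bool (x \<in> C) - of_bool (r \<in> C)) * (of_bool (z \<in> C) - of_bool (r \<in> C)))) / 2"
    unfolding pinv_def cent_def add_divide_distrib[symmetric] diff_divide_distrib[symmetric] sum.distrib[symmetric] sum_subtractf[symmetric]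
    by (intro arg_cong2[where f="(/)"] sum.cong refl) (simp add: algebra_simps)
  also have "\<dots> = ((\<Sum>C\<in>Pow M. of_bool (x \<in> C) * of_bool (z \<in> C) * of_bool (r \<notin> C) * pairw M C)
      + (\<Sum>C\<in>Pow M. of_bool (x \<notin> C) * of_bool (z \<notin> C) * of_bool (r \<in> C) * pairw M C)) / 2"
    unfolding sum.distrib[symmetric]
    by (intro arg_cong2[where f="(/)"] sum.cong refl) auto
  also have "(\<Sum>C\<in>Pow M. of_bool (x \<notin> C) * of_bool (z \<notin> C) * of_bool (r \<in> C) * pairw M C)
     = (\<Sum>C\<in>Pow M. of_bool (x \<in> C) * of_bool (z \<in> C) * of_bool (r \<notin> C) * pairw M C)"
    by (subst sum_Pow_compl[OF M, symmetric]) (use assms in \<open>auto simp: pairw_compl intro!: sum.cong\<close>)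
  finally show ?thesis by (simp add: green_def pairw_def)
qed

text \<open>Two columns \<open>z\<close> and \<open>r\<close> of \<open>pinv\<close> differ by the
  Green function rooted at \<open>r\<close>, up to a constant, so \<open>lap_green\<close> gives the
  Laplacian of the difference; at \<open>x = r\<close> the root \<open>z\<close> is used instead.
  Averaging over all \<open>r\<close> isolates one column, because the rows of \<open>pinv\<close>
  sum to zero.\<close>

lemma lap_pinv:
  assumes M: "finite M" and x: "x \<in> M" and z: "z \<in> M"
  shows "lap M (\<lambda>x. pinv M x z) x = t M * (of_bool (x = z) - 1 / real (card M))"
proof -
  define h where "h z = lap M (\<lambda>x. pinv M x z) x" for z
  have n: "real (card M) > 0" using M x by (auto simp: card_gt_0_iff)
  have diff: "h z - h r = t M * (of_bool (x = z) - of_bool (x = r))" if "z \<in> M" "r \<in> M" for z r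
  proof (cases "x = r")
    case False
    have "h z - h r = lap M (\<lambda>x. green M r x z) x"
      unfolding h_def lap_def sum_subtractf[symmetric]
      by (intro sum.cong refl) (simp add: green_pinv[OF M _ that] x algebra_simps)
    then show ?thesis using lap_green[OF M x that(2) False] False by simp
  next
    case xr: True
    show ?thesis
    proof (cases "x = z")
      case False
      have "h r - h z = lap M (\<lambda>x. green M z x r) x"
        unfolding h_def lap_def sum_subtractf[symmetric]
        by (intro sum.cong refl) (simp add: green_pinv[OF M _ that(2,1)] x algebra_simps)
      then show ?thesis using lap_green[OF M x that(1) False] xr False by simp
    qed (use xr in simp)
  qed
  have "(\<Sum>r\<in>M. h r) = (\<Sum>w\<in>M. a x w * ((\<Sum>r\<in>M. pinv M x r) - (\<Sum>r\<in>M. pinv M w r)))"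
    unfolding h_def lap_def by (subst sum.swap) (simp only: sum_distrib_left[symmetric] sum_subtractf)
  then have "(\<Sum>r\<in>M. h r) = 0" using sum_pinv[OF M] by simp
  then have "real (card M) * h z = (\<Sum>r\<in>M. h z - h r)"
    by (simp add: sum_subtractf)
  also have "\<dots> = (\<Sum>r\<in>M. t M * of_bool (x = z) - (if r = x then t M else 0))"
    by (intro sum.cong refl) (simp add: diff[OF z] right_diff_distrib)
  also have "\<dots> = real (card M) * (t M * of_bool (x = z)) - t M"
    using M x by (simp add: sum_subtractf)
  finally show ?thesis using n by (simp add: h_def field_simps)
qed

section \<open>Trace identities and the inequality for forests with two components\<close>

definition trace_pinv :: "'a set \<Rightarrow> real" where
  "trace_pinv M = (\<Sum>x\<in>M. pinv M x x)"

text \<open>The squared norm of \<open>cent M C\<close> on \<open>M\<close> is |C| |M - C| /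
  |M|.\<close>

lemma trace_pinv_eq:
  assumes M: "finite M"
  shows "2 * real (card M) * trace_pinv M = (\<Sum>C\<in>Pow M. pairw M C * (real (card C) * real (card (M - C))))"
proof (cases "M = {}")
  case False
  define n where "n = real (card M)"
  have n: "n > 0" using False M by (simp add: n_def card_gt_0_iff)
  have "2 * trace_pinv M = (\<Sum>C\<in>Pow M. pairw M C * (\<Sum>x\<in>M. cent M C x * cent M C x))"
    unfolding trace_pinv_def pinv_def sum_divide_distrib[symmetric] sum_distrib_left
    by (subst sum.swap) simp
  also have "\<dots> = (\<Sum>C\<in>Pow M. pairw M C * (real (card C) * real (card (M - C)) / n))"
  proof (intro sum.cong refl arg_cong2[where f="(*)"])
    fix C assume C: "C \<in> Pow M"
    have k: "real (card (M - C)) = n - real (card C)"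
      using C M by (simp add: n_def card_Diff_subset finite_subset card_mono of_nat_diff)
    have "(\<Sum>x\<in>M. cent M C x * cent M C x) = (\<Sum>x\<in>M. cent M C x * of_bool (x \<in> C)) - (\<Sum>x\<in>M. cent M C x) * (real (card C) / n)"
      unfolding sum_distrib_right sum_subtractf[symmetric]
      by (intro sum.cong refl) (simp add: cent_def n_def algebra_simps)
    also have "(\<Sum>x\<in>M. cent M C x * of_bool (x \<in> C)) = (\<Sum>x\<in>C. cent M C x)"
      using sum_of_bool_mem[OF M, of C "cent M C"] C by (simp add: mult.commute)
    also have "\<dots> = real (card C) * (1 - real (card C) / n)"
      by (simp add: cent_def n_def)
    also have "\<dots> - (\<Sum>x\<in>M. cent M C x) * (real (card C) / n) = real (card C) * (1 - real (card C) / n)"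
      using sum_cent[OF M, of C] C by simp
    also have "\<dots> = real (card C) * real (card (M - C)) / n"
      using n by (simp add: k field_simps)
    finally show "(\<Sum>x\<in>M. cent M C x * cent M C x) = real (card C) * real (card (M - C)) / n" .
  qed
  also have "\<dots> = (\<Sum>C\<in>Pow M. pairw M C * (real (card C) * real (card (M - C)))) / n"
    by (simp add: sum_divide_distrib)
  finally show ?thesis using n by (simp add: n_def field_simps)
qed (simp add: trace_pinv_def pairw_def t_empty)

text \<open>A set and its complement carry the same weight, so the mean size is half of |M|.\<close>

lemma sum_pairw_size:
  assumes M: "finite M"
  shows "2 * (\<Sum>C\<in>Pow M. pairw M C * real (card (M - C))) = real (card M) * (\<Sum>C\<in>Pow M. pairw M C)"
proof -
  have "(\<Sum>C\<in>Pow M. pairw M C * real (card (M - C))) = (\<Sum>C\<in>Pow M. pairw M (M - C) * real (card (M - (M - C))))"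
    by (rule sum_Pow_compl[OF M, symmetric])
  also have "\<dots> = (\<Sum>C\<in>Pow M. pairw M C * (real (card M) - real (card (M - C))))"
    by (intro sum.cong refl)
      (use M in \<open>auto simp: pairw_compl double_diff card_Diff_subset finite_subset card_mono of_nat_diff\<close>)
  finally show ?thesis
    by (simp add: algebra_simps sum_subtractf sum_distrib_left)
qed

text \<open>\<open>sum_green2\<close> is summed over all roots \<open>r\<close>, so each
  \<open>D\<close> is counted |M - D| times and the left side depends only on sizes. On the right,
  \<open>green2_eq\<close> gives minors of \<open>green\<close>, which \<open>green_pinv\<close>
  expresses by \<open>pinv\<close>.\<close>

lemma sum_gram:
  assumes M: "finite M" and T: "t M > 0"
  shows "t M * (\<Sum>C\<in>Pow M. pairw M C)
    = t M * trace_pinv M * (2 + 4 / real (card M)) - (\<Sum>x\<in>M. \<Sum>y\<in>M. a x y * (pinv M x x * pinv M y y - pinv M x y * pinv M x y))"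
proof -
  define n where "n = real (card M)"
  define T where "T = t M"
  define \<tau> where "\<tau> = trace_pinv M"
  define W where "W = (\<Sum>x\<in>M. \<Sum>y\<in>M. a x y * (pinv M x x * pinv M y y - pinv M x y * pinv M x y))"
  define \<Phi> where "\<Phi> = (\<Sum>C\<in>Pow M. pairw M C)"
  have "M \<noteq> {}" using T t_empty by auto
  then have n: "n > 0" using M by (simp add: n_def card_gt_0_iff)
  have lap: "(\<Sum>y\<in>M. a x y * (pinv M x z - pinv M y z)) = T * (of_bool (x = z) - 1 / n)" if "x \<in> M" "z \<in> M" for x z
    using lap_pinv[OF M that] by (simp add: lap_def T_def n_def)
  have s1: "(\<Sum>r\<in>M. \<Sum>D\<in>Pow M. of_bool (r \<notin> D) * (2 * (real (card D) - 1) * pairw M D)) = 4 * n * \<tau> - n * \<Phi>"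
  proof -
    have "(\<Sum>r\<in>M. \<Sum>D\<in>Pow M. of_bool (r \<notin> D) * (2 * (real (card D) - 1) * pairw M D))
      = (\<Sum>D\<in>Pow M. (\<Sum>r\<in>M. of_bool (r \<in> M - D) * 1) * (2 * (real (card D) - 1) * pairw M D))"
      by (subst sum.swap) (simp add: sum_distrib_right)
    also have "\<dots> = (\<Sum>D\<in>Pow M. real (card (M - D)) * (2 * (real (card D) - 1) * pairw M D))"
    proof (intro sum.cong refl arg_cong2[where f="(*)"])
      fix D
      show "(\<Sum>r\<in>M. of_bool (r \<in> M - D) * 1) = real (card (M - D))"
        using sum_of_bool_mem[OF M, of "M - D" "\<lambda>_. 1"] by simp
    qed
    also have "\<dots> = 2 * (\<Sum>D\<in>Pow M. pairw M D * (real (card D) * real (card (M - D)))) - 2 * (\<Sum>C\<in>Pow M. pairw M C * real (card (M - C)))"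
      by (simp add: sum_distrib_left sum_subtractf[symmetric] algebra_simps)
    also have "\<dots> = 4 * n * \<tau> - n * \<Phi>"
      unfolding trace_pinv_eq[OF M, symmetric] sum_pairw_size[OF M] by (simp add: n_def \<tau>_def \<Phi>_def)
    finally show ?thesis .
  qed
  have g2: "T * green2 M r y x x = green M r x x * green M r y y - green M r x y * green M r x y"
    if "x \<in> M" "y \<in> M" "r \<in> M" for x y r
  proof (cases "y = r")
    case True
    then have "green2 M r y x x = 0" by (simp add: green2_def)
    with True show ?thesis by simp
  next
    case False
    then show ?thesis using green2_eq[OF M that(3,2) _ that(1,1) T] by (simp add: T_def green_sym[of M r y x])
  qed
  have "T * (4 * n * \<tau> - n * \<Phi>) = (\<Sum>r\<in>M. \<Sum>x\<in>M. \<Sum>y\<in>M. a x y * (T * green2 M r y x x))"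
    unfolding s1[symmetric] sum_distrib_left using sum_green2[OF M]
    by (simp add: sum_distrib_left[symmetric] mult.left_commute)
  \<comment> \<open>The terms are grouped for the summation over \<open>r\<close>: those linear in
    the entries of column \<open>r\<close> vanish because rows sum to zero, and
    \<open>pinv M r r\<close> yields the trace.\<close>
  also have "\<dots> = (\<Sum>r\<in>M. \<Sum>x\<in>M. \<Sum>y\<in>M. a x y *
      ((pinv M x x * pinv M y y - pinv M x y * pinv M x y) + pinv M r r * ((pinv M x x - pinv M y x) + (pinv M y y - pinv M x y))
        - (pinv M x r - pinv M y r) * (pinv M x r - pinv M y r)
        - pinv M x r * (2 * (pinv M y y - pinv M x y)) - pinv M y r * (2 * (pinv M x x - pinv M x y))))"
    (is "_ = (\<Sum>r\<in>M. \<Sum>x\<in>M. \<Sum>y\<in>M. a x y * ?E r x y)")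
    by (intro sum.cong refl arg_cong2[where f="(*)"])
      (simp add: g2 green_pinv[OF M], simp add: algebra_simps pinv_sym)
  also have "\<dots> = (\<Sum>x\<in>M. \<Sum>y\<in>M. a x y * (\<Sum>r\<in>M. ?E r x y))"
  proof -
    have "(\<Sum>r\<in>M. \<Sum>x\<in>M. \<Sum>y\<in>M. a x y * ?E r x y) = (\<Sum>x\<in>M. \<Sum>r\<in>M. \<Sum>y\<in>M. a x y * ?E r x y)"
      by (rule sum.swap)
    also have "\<dots> = (\<Sum>x\<in>M. \<Sum>y\<in>M. \<Sum>r\<in>M. a x y * ?E r x y)"
      by (intro sum.cong refl sum.swap)
    finally show ?thesis by (simp only: sum_distrib_left)
  qed
  also have "\<dots> = (\<Sum>x\<in>M. \<Sum>y\<in>M. a x y * (n * (pinv M x x * pinv M y y - pinv M x y * pinv M x y)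
       + \<tau> * ((pinv M x x - pinv M y x) + (pinv M y y - pinv M x y))
       - (\<Sum>r\<in>M. (pinv M x r - pinv M y r) * (pinv M x r - pinv M y r))))"
    by (intro sum.cong refl arg_cong2[where f="(*)"])
      (simp add: sum.distrib sum_subtractf sum_distrib_right[symmetric] sum_pinv[OF M] trace_pinv_def \<tau>_def n_def)
  also have "\<dots> = n * W + \<tau> * (\<Sum>x\<in>M. \<Sum>y\<in>M. a x y * ((pinv M x x - pinv M y x) + (pinv M y y - pinv M x y)))
     - (\<Sum>x\<in>M. \<Sum>y\<in>M. a x y * (\<Sum>r\<in>M. (pinv M x r - pinv M y r) * (pinv M x r - pinv M y r)))"
    unfolding W_def sum_distrib_left sum.distrib[symmetric] sum_subtractf[symmetric]
    by (intro sum.cong refl) (simp add: algebra_simps sum_distrib_left)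
  also have "(\<Sum>x\<in>M. \<Sum>y\<in>M. a x y * ((pinv M x x - pinv M y x) + (pinv M y y - pinv M x y))) = 2 * (n - 1) * T"
  proof -
    have "(\<Sum>x\<in>M. \<Sum>y\<in>M. a x y * (pinv M y y - pinv M x y)) = (\<Sum>x\<in>M. \<Sum>y\<in>M. a x y * (pinv M x x - pinv M y x))"
      by (subst sum.swap) (simp add: a_sym)
    moreover have "(\<Sum>x\<in>M. \<Sum>y\<in>M. a x y * (pinv M x x - pinv M y x)) = (\<Sum>x\<in>M. T * (1 - 1 / n))"
      by (intro sum.cong refl) (simp add: lap)
    ultimately have "(\<Sum>x\<in>M. \<Sum>y\<in>M. a x y * ((pinv M x x - pinv M y x) + (pinv M y y - pinv M x y))) = 2 * (n * (T * (1 - 1 / n)))"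
      by (simp only: distrib_left sum.distrib) (simp add: n_def)
    also have "\<dots> = 2 * (n - 1) * T" using n by (simp add: field_simps)
    finally show ?thesis .
  qed
  \<comment> \<open>This is the total Dirichlet energy of the columns of \<open>pinv\<close>.
    Antisymmetry of the differences makes it twice the pairing of the columns with their Laplacians,
    known from \<open>lap\<close>.\<close>
  also have "(\<Sum>x\<in>M. \<Sum>y\<in>M. a x y * (\<Sum>r\<in>M. (pinv M x r - pinv M y r) * (pinv M x r - pinv M y r))) = 2 * T * \<tau>"
  proof -
    define d where "d x y r = pinv M x r - pinv M y r" for x y r
    have "(\<Sum>x\<in>M. \<Sum>y\<in>M. a x y * (\<Sum>r\<in>M. d x y r * d x y r)) = (\<Sum>x\<in>M. \<Sum>y\<in>M. a x y * (\<Sum>r\<in>M. d x y r * pinv M x r)) - (\<Sum>x\<in>M. \<Sum>y\<in>M. a x y * (\<Sum>r\<in>M. d x y r * pinv M y r))"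
      by (simp only: sum_subtractf[symmetric] right_diff_distrib[symmetric]) (simp add: d_def)
    also have "(\<Sum>x\<in>M. \<Sum>y\<in>M. a x y * (\<Sum>r\<in>M. d x y r * pinv M y r)) = - (\<Sum>x\<in>M. \<Sum>y\<in>M. a x y * (\<Sum>r\<in>M. d x y r * pinv M x r))"
    proof -
      have "d x y r = - d y x r" for x y r by (simp add: d_def)
      then have "(\<Sum>r\<in>M. d y x r * pinv M x r) = - (\<Sum>r\<in>M. d x y r * pinv M x r)" for x y
        unfolding sum_negf[symmetric] by (intro sum.cong refl) (metis mult_minus_left)
      then show ?thesis
        by (subst sum.swap) (simp add: a_sym[of _ x for x] sum_negf)
    qed
    also have "(\<Sum>x\<in>M. \<Sum>y\<in>M. a x y * (\<Sum>r\<in>M. d x y r * pinv M x r)) = (\<Sum>x\<in>M. \<Sum>r\<in>M. (\<Sum>y\<in>M. a x y * d x y r) * pinv M x r)"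
      unfolding sum_distrib_left sum_distrib_right mult.assoc
      by (rule sum.cong[OF refl]) (rule sum.swap)
    also have "\<dots> = (\<Sum>x\<in>M. \<Sum>r\<in>M. T * (of_bool (x = r) - 1 / n) * pinv M x r)"
      unfolding d_def by (intro sum.cong refl) (simp add: lap)
    also have "\<dots> = (\<Sum>x\<in>M. T * ((\<Sum>r\<in>M. if r = x then pinv M x x else 0) - (\<Sum>r\<in>M. pinv M x r) / n))"
      unfolding sum_divide_distrib sum_subtractf[symmetric] sum_distrib_left
      by (intro sum.cong refl) (auto simp: algebra_simps)
    also have "\<dots> = T * \<tau>"
      using sum_pinv[OF M] M by (simp add: sum_distrib_left[symmetric] trace_pinv_def \<tau>_def)
    finally show ?thesis by (simp add: d_def)
  qed
  finally have "n * (T * \<Phi>) = n * (T * \<tau> * (2 + 4 / n) - W)"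
    using n by (simp add: field_simps)
  then show ?thesis using n by (simp add: T_def \<Phi>_def \<tau>_def W_def n_def)
qed

definition complete_on :: "'a set \<Rightarrow> bool" where
  "complete_on M \<longleftrightarrow> (\<forall>x\<in>M. \<forall>y\<in>M. x \<noteq> y \<longrightarrow> a x y = 1)"

text \<open>\<open>U - W\<close> equals a sum \<open>R\<close> of weighted squares and degree
  deficits, each nonnegative. On the complete graph \<open>pinv\<close> is explicit and every
  summand of \<open>R\<close> vanishes.\<close>

lemma gram_bound:
  assumes M: "finite M" and T: "t M > 0"
  defines "n \<equiv> real (card M)"
  defines "W \<equiv> (\<Sum>x\<in>M. \<Sum>y\<in>M. a x y * (pinv M x x * pinv M y y - pinv M x y * pinv M x y))"
  defines "U \<equiv> 2 * t M * (1 - 1 / n) * trace_pinv M - (t M)\<^sup>2 * (1 - 1 / n)"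
  shows "W \<le> U" and "complete_on M \<Longrightarrow> W = U"
proof -
  define S where "S = t M"
  have "M \<noteq> {}" using T t_empty by auto
  then have n: "n > 0" using M by (simp add: n_def card_gt_0_iff)
  have lap: "(\<Sum>y\<in>M. a x y * (pinv M x z - pinv M y z)) = S * (of_bool (x = z) - 1 / n)" if "x \<in> M" "z \<in> M" for x z
    using lap_pinv[OF M that] by (simp add: lap_def S_def n_def)
  define \<delta> where "\<delta> x y = pinv M x x - pinv M x y" for x y
  \<comment> \<open>\<open>S / n\<close> is the value of \<open>\<delta> x y\<close> for distinct
    vertices of a complete graph; the last sum collects how far the degrees fall short of
    \<open>n - 1\<close>.\<close>
  define R where "R = (\<Sum>x\<in>M. \<Sum>y\<in>M. a x y * ((pinv M x x - pinv M y y)\<^sup>2 / 2 + (\<delta> x y - S / n)\<^sup>2))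
      + (\<Sum>x\<in>M. (n - 1 - (\<Sum>y\<in>M. a x y)) * (S / n)\<^sup>2)"
  have eq: "W = U - R"
  proof -
    have sq: "(\<Sum>x\<in>M. \<Sum>y\<in>M. a x y * (pinv M y y)\<^sup>2) = (\<Sum>x\<in>M. \<Sum>y\<in>M. a x y * (pinv M x x)\<^sup>2)"
      by (subst sum.swap) (simp add: a_sym)
    \<comment> \<open>The product of two diagonal entries is the mean of their squares minus half
      the square of their difference. What remains is antisymmetric in \<open>x\<close> and
      \<open>y\<close> and sums to zero by \<open>sq\<close>.\<close>
    have "W = (\<Sum>x\<in>M. \<Sum>y\<in>M. a x y * (2 * pinv M x x * \<delta> x y - (\<delta> x y)\<^sup>2 - (pinv M x x - pinv M y y)\<^sup>2 / 2 + ((pinv M y y)\<^sup>2 - (pinv M x x)\<^sup>2) / 2))"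
      unfolding W_def \<delta>_def by (intro sum.cong refl arg_cong2[where f="(*)"]) (simp add: power2_eq_square algebra_simps add_divide_distrib diff_divide_distrib)
    also have "\<dots> = (\<Sum>x\<in>M. \<Sum>y\<in>M. a x y * (2 * pinv M x x * \<delta> x y - (\<delta> x y)\<^sup>2 - (pinv M x x - pinv M y y)\<^sup>2 / 2))
        + ((\<Sum>x\<in>M. \<Sum>y\<in>M. a x y * (pinv M y y)\<^sup>2) - (\<Sum>x\<in>M. \<Sum>y\<in>M. a x y * (pinv M x x)\<^sup>2)) / 2"
      unfolding sum_divide_distrib sum.distrib[symmetric] sum_subtractf[symmetric]
      by (intro sum.cong refl) (simp add: algebra_simps add_divide_distrib diff_divide_distrib)
    also have "\<dots> = (\<Sum>x\<in>M. \<Sum>y\<in>M. a x y * (2 * pinv M x x * \<delta> x y - (\<delta> x y)\<^sup>2 - (pinv M x x - pinv M y y)\<^sup>2 / 2))"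
      using sq by simp
    also have "\<dots> = (\<Sum>x\<in>M. \<Sum>y\<in>M. a x y * ((2 * pinv M x x - 2 * S / n) * \<delta> x y + (S / n)\<^sup>2
        - ((pinv M x x - pinv M y y)\<^sup>2 / 2 + (\<delta> x y - S / n)\<^sup>2)))"
      by (intro sum.cong refl arg_cong2[where f="(*)"]) (simp add: power2_eq_square algebra_simps)
    also have "\<dots> = (\<Sum>x\<in>M. (2 * pinv M x x - 2 * S / n) * (\<Sum>y\<in>M. a x y * \<delta> x y) + (\<Sum>y\<in>M. a x y) * (S / n)\<^sup>2
        - (\<Sum>y\<in>M. a x y * ((pinv M x x - pinv M y y)\<^sup>2 / 2 + (\<delta> x y - S / n)\<^sup>2)))"
      unfolding sum_distrib_left sum_distrib_right sum.distrib[symmetric] sum_subtractf[symmetric]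
      by (intro sum.cong refl) (simp add: algebra_simps)
    also have "\<dots> = (\<Sum>x\<in>M. (2 * pinv M x x - 2 * S / n) * (S * (1 - 1 / n)) + (\<Sum>y\<in>M. a x y) * (S / n)\<^sup>2
        - (\<Sum>y\<in>M. a x y * ((pinv M x x - pinv M y y)\<^sup>2 / 2 + (\<delta> x y - S / n)\<^sup>2)))"
    proof (intro sum.cong refl)
      fix x assume x: "x \<in> M"
      have "(\<Sum>y\<in>M. a x y * \<delta> x y) = S * (1 - 1 / n)"
        using lap[OF x x] by (simp add: \<delta>_def pinv_sym)
      then show "(2 * pinv M x x - 2 * S / n) * (\<Sum>y\<in>M. a x y * \<delta> x y) + (\<Sum>y\<in>M. a x y) * (S / n)\<^sup>2
        - (\<Sum>y\<in>M. a x y * ((pinv M x x - pinv M y y)\<^sup>2 / 2 + (\<delta> x y - S / n)\<^sup>2))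
        = (2 * pinv M x x - 2 * S / n) * (S * (1 - 1 / n)) + (\<Sum>y\<in>M. a x y) * (S / n)\<^sup>2
        - (\<Sum>y\<in>M. a x y * ((pinv M x x - pinv M y y)\<^sup>2 / 2 + (\<delta> x y - S / n)\<^sup>2))" by simp
    qed
    also have "\<dots> = 2 * (S * (1 - 1 / n)) * trace_pinv M - (\<Sum>x\<in>M. 2 * S / n * (S * (1 - 1 / n)) - (n - 1) * (S / n)\<^sup>2) - R"
      unfolding R_def trace_pinv_def sum_distrib_left
      by (simp add: sum.distrib sum_subtractf algebra_simps)
    also have "(\<Sum>x\<in>M. 2 * S / n * (S * (1 - 1 / n)) - (n - 1) * (S / n)\<^sup>2) = n * (2 * S / n * (S * (1 - 1 / n)) - (n - 1) * (S / n)\<^sup>2)"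
      by (simp add: n_def)
    also have "\<dots> = S\<^sup>2 * (1 - 1 / n)"
      using n by (simp add: field_simps power2_eq_square)
    finally show ?thesis by (simp add: U_def S_def)
  qed
  have deg: "(\<Sum>y\<in>M. a x y) \<le> n - 1" if "x \<in> M" for x
  proof -
    have "(\<Sum>y\<in>M. a x y) = (\<Sum>y\<in>M - {x}. a x y)"
      using M that by (simp add: sum.remove a_irrefl)
    also have "\<dots> \<le> (\<Sum>y\<in>M - {x}. 1)" by (intro sum_mono a_le_1)
    also have "\<dots> = n - 1" using M that card_gt_0_iff[of M] by (auto simp: n_def of_nat_diff)
    finally show ?thesis .
  qed
  have "R \<ge> 0"
    unfolding R_def by (intro add_nonneg_nonneg sum_nonneg mult_nonneg_nonneg) (use deg a_nonneg in auto)
  then show "W \<le> U" using eq by simp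
  assume K: "complete_on M"
  have dg: "(\<Sum>y\<in>M. a x y * f y) = (\<Sum>y\<in>M. f y) - f x" if "x \<in> M" for x f
  proof -
    have "(\<Sum>y\<in>M. a x y * f y) = (\<Sum>y\<in>M - {x}. a x y * f y)"
      using M that by (simp add: sum.remove a_irrefl)
    also have "\<dots> = (\<Sum>y\<in>M - {x}. f y)"
      using K that by (intro sum.cong refl) (auto simp: complete_on_def)
    also have "\<dots> = (\<Sum>y\<in>M. f y) - f x" using M that by (simp add: sum_diff1)
    finally show ?thesis .
  qed
  \<comment> \<open>On the complete graph the Laplacian multiplies a vector of sum zero by
    \<open>n\<close>, so \<open>lap\<close> can be solved for the entries of
    \<open>pinv\<close>.\<close>
  have p: "pinv M x z = S / n * (of_bool (x = z) - 1 / n)" if "x \<in> M" "z \<in> M" for x z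
  proof -
    have "(\<Sum>y\<in>M. a x y * (pinv M x z - pinv M y z)) = n * pinv M x z"
      unfolding dg[OF that(1)] using sum_pinv[OF M, of z] by (simp add: sum_subtractf pinv_sym n_def)
    then show ?thesis using lap[OF that] n by (simp add: field_simps)
  qed
  have "R = 0"
  proof -
    have "(\<Sum>y\<in>M. a x y) = n - 1" if "x \<in> M" for x
      using dg[OF that, of "\<lambda>_. 1"] by (simp add: n_def)
    moreover have "a x y * ((pinv M x x - pinv M y y)\<^sup>2 / 2 + (\<delta> x y - S / n)\<^sup>2) = 0" if "x \<in> M" "y \<in> M" for x y
      using that by (cases "x = y") (simp_all add: a_irrefl \<delta>_def p right_diff_distrib)
    ultimately show ?thesis by (simp add: R_def del: mult_eq_0_iff cong: sum.cong)
  qed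
  then show "W = U" using eq by simp
qed

text \<open>For \<open>c + d = n\<close> one has \<open>c^2 - c d + d^2 = n^2 - 3 c d\<close>, so
  \<open>Q\<close> combines the number of forests with the trace. The sum over \<open>C\<close>
  meets each forest twice, hence \<open>n * (n - 1)\<close> without a factor 1/2. If
  \<open>t M = 0\<close>, the bound is the nonnegativity of \<open>Q\<close>.\<close>

lemma two_forests:
  assumes M: "finite M"
  defines "n \<equiv> real (card M)"
  defines "Q \<equiv> (\<Sum>C\<in>Pow M. pairw M C * ((real (card C))\<^sup>2 - real (card C) * real (card (M - C)) + (real (card (M - C)))\<^sup>2))"
  shows "n * (n - 1) * t M \<le> Q" and "complete_on M \<Longrightarrow> t M > 0 \<Longrightarrow> Q = n * (n - 1) * t M"
proof -
  have Q: "Q = n\<^sup>2 * (\<Sum>C\<in>Pow M. pairw M C) - 6 * n * trace_pinv M"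
  proof -
    have "Q = (\<Sum>C\<in>Pow M. n\<^sup>2 * pairw M C - 3 * (pairw M C * (real (card C) * real (card (M - C)))))"
      unfolding Q_def
    proof (intro sum.cong refl)
      fix C assume C: "C \<in> Pow M"
      have k: "n = real (card C) + real (card (M - C))"
        using C M by (simp add: n_def card_Diff_subset finite_subset card_mono of_nat_diff)
      show "pairw M C * ((real (card C))\<^sup>2 - real (card C) * real (card (M - C)) + (real (card (M - C)))\<^sup>2) =
         n\<^sup>2 * pairw M C - 3 * (pairw M C * (real (card C) * real (card (M - C))))"
        unfolding k by (simp add: power2_eq_square algebra_simps)
    qed
    then show ?thesis
      using trace_pinv_eq[OF M] by (simp add: sum_subtractf sum_distrib_left[symmetric] n_def)
  qed
  \<comment> \<open>The bracket is the difference \<open>U - W\<close> of \<open>gram_bound\<close>,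
    by \<open>sum_gram\<close>.\<close>
  have main: "t M * Q = n * (n - 1) * (t M)\<^sup>2 + n\<^sup>2 * (2 * t M * (1 - 1 / n) * trace_pinv M - (t M)\<^sup>2 * (1 - 1 / n)
      - (\<Sum>x\<in>M. \<Sum>y\<in>M. a x y * (pinv M x x * pinv M y y - pinv M x y * pinv M x y)))" if T: "t M > 0"
  proof -
    have "M \<noteq> {}" using T t_empty by auto
    then have n: "n > 0" using M by (simp add: n_def card_gt_0_iff)
    have "t M * Q = n\<^sup>2 * (t M * (\<Sum>C\<in>Pow M. pairw M C)) - 6 * n * t M * trace_pinv M"
      unfolding Q by (simp add: algebra_simps)
    moreover have "n\<^sup>2 * (S * \<tau> * (2 + 4 / n) - W) - 6 * n * S * \<tau>
       = n * (n - 1) * S\<^sup>2 + n\<^sup>2 * (2 * S * (1 - 1 / n) * \<tau> - S\<^sup>2 * (1 - 1 / n) - W)" for S \<tau> W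
      using n by (simp add: field_simps power2_eq_square)
    ultimately show ?thesis
      unfolding sum_gram[OF M T] n_def[symmetric] by simp
  qed
  show "n * (n - 1) * t M \<le> Q"
  proof (cases "t M > 0")
    case True
    have "t M * (n * (n - 1) * t M) \<le> t M * Q"
      unfolding main[OF True] using gram_bound(1)[OF M True] by (simp add: n_def power2_eq_square mult_ac)
    then show ?thesis using True by simp
  next
    case False
    then have "t M = 0" using t_nonneg[of M] by simp
    moreover have "Q \<ge> 0"
      unfolding Q_def
    proof (intro sum_nonneg mult_nonneg_nonneg pairw_nonneg)
      fix C
      have "0 \<le> (x - y)\<^sup>2 + x * y" if "x \<ge> 0" "y \<ge> 0" for x y :: real using that by simp
      from this[of "real (card C)" "real (card (M - C))"]
      show "0 \<le> (real (card C))\<^sup>2 - real (card C) * real (card (M - C)) + (real (card (M - C)))\<^sup>2"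
        by (simp add: power2_eq_square algebra_simps)
    qed
    ultimately show ?thesis by simp
  qed
  assume K: "complete_on M" and T: "t M > 0"
  have "t M * Q = t M * (n * (n - 1) * t M)"
    unfolding main[OF T] using gram_bound(2)[OF M T K] by (simp add: n_def power2_eq_square mult_ac)
  then show "Q = n * (n - 1) * t M" using T by simp
qed

section \<open>Forests by number of components\<close>

text \<open>The division accounts for the choice of the component \<open>U\<close> among the \<open>k + 1\<close> components.\<close>

primrec forests :: "nat \<Rightarrow> 'a set \<Rightarrow> real" where
  "forests 0 V = of_bool (V = {})"
| "forests (Suc k) V = (\<Sum>U\<in>Pow V. t U * forests k (V - U)) / (real k + 1)"

text \<open>The index is one below the number of components: each component of a forest with
  \<open>k + 1\<close> components is taken once as \<open>U\<close>, and \<open>k\<close> others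
  remain.\<close>

definition sqsum :: "nat \<Rightarrow> 'a set \<Rightarrow> real" where
  "sqsum k V = (\<Sum>U\<in>Pow V. (real (card U))\<^sup>2 * (t U * forests k (V - U)))"

lemma forests_nonneg: "0 \<le> forests k V"
  by (induction k arbitrary: V) (auto intro!: divide_nonneg_nonneg sum_nonneg mult_nonneg_nonneg t_nonneg)

lemma sum_forests: "(\<Sum>U\<in>Pow V. t U * forests k (V - U)) = (real k + 1) * forests (Suc k) V"
  by simp

declare forests.simps(2) [simp del]

lemma sum_full:
  assumes "finite V"
  shows "(\<Sum>U\<in>Pow V. g U * forests 0 (V - U)) = g V"
proof -
  have "(\<Sum>U\<in>Pow V. g U * forests 0 (V - U)) = (\<Sum>U\<in>Pow V. if U = V then g V else 0)"
    by (intro sum.cong refl) auto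
  then show ?thesis using assms by simp
qed

lemma forests_1: "finite V \<Longrightarrow> forests 1 V = t V"
  using sum_full[of V t] by (simp add: forests.simps(2))

lemma sqsum_0: "finite V \<Longrightarrow> sqsum 0 V = (real (card V))\<^sup>2 * t V"
  using sum_full[of V "\<lambda>U. (real (card U))\<^sup>2 * t U"] by (simp add: sqsum_def mult.assoc)

text \<open>Every component is nonempty because \<open>t {} = 0\<close>.\<close>

lemma forests_zero:
  assumes "finite V" "card V < k"
  shows "forests k V = 0"
  using assms
proof (induction k arbitrary: V)
  case (Suc k)
  have "t U * forests k (V - U) = 0" if U: "U \<in> Pow V" for U
  proof (cases "U = {}")
    case False
    then have "card (V - U) < card V"
      using U Suc.prems by (intro psubset_card_mono) auto
    then show ?thesis using Suc by simp
  qed (simp add: t_empty)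
  then have "(\<Sum>U\<in>Pow V. t U * forests k (V - U)) = 0" by (intro sum.neutral ballI)
  then show ?case by (simp add: forests.simps(2))
qed simp

text \<open>The component of \<open>r\<close> is a canonical choice, so no division is left. In the
  induction, a selected component that avoids \<open>r\<close> is exchanged with the component of
  \<open>r\<close>; such selections amount to \<open>k + 1\<close> times the rooted sum.\<close>

lemma forests_root:
  assumes "finite V" "r \<in> V"
  shows "(\<Sum>U\<in>Pow V. of_bool (r \<in> U) * (t U * forests k (V - U))) = forests (Suc k) V"
  using assms
proof (induction k arbitrary: V)
  case 0
  then show ?case
    using sum_full[of V "\<lambda>U. of_bool (r \<in> U) * t U"] forests_1[of V] by (simp add: mult.assoc)
next
  case (Suc k)
  define A where "A = (\<Sum>U\<in>Pow V. of_bool (r \<in> U) * (t U * forests (Suc k) (V - U)))"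
  have "(\<Sum>U\<in>Pow V. of_bool (r \<notin> U) * (t U * forests (Suc k) (V - U)))
     = (\<Sum>U\<in>Pow V. \<Sum>C\<in>Pow (V - U). of_bool (r \<in> C) * (t U * (t C * forests k (V - U - C))))"
  proof (rule sum.cong[OF refl])
    fix U assume U: "U \<in> Pow V"
    show "of_bool (r \<notin> U) * (t U * forests (Suc k) (V - U))
      = (\<Sum>C\<in>Pow (V - U). of_bool (r \<in> C) * (t U * (t C * forests k (V - U - C))))"
    proof (cases "r \<in> U")
      case True
      then show ?thesis by (auto intro!: sum.neutral)
    next
      case False
      then have "forests (Suc k) (V - U) = (\<Sum>C\<in>Pow (V - U). of_bool (r \<in> C) * (t C * forests k (V - U - C)))"
        using Suc.IH[of "V - U"] Suc.prems by simp
      with False show ?thesis by (simp add: sum_distrib_left mult_ac)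
    qed
  qed
  also have "\<dots> = (\<Sum>C\<in>Pow V. \<Sum>U\<in>Pow (V - C). of_bool (r \<in> C) * (t U * (t C * forests k (V - U - C))))"
    by (rule sum_Pow_swap) (use Suc.prems in simp)
  also have "\<dots> = (\<Sum>C\<in>Pow V. of_bool (r \<in> C) * (t C * (\<Sum>U\<in>Pow (V - C). t U * forests k (V - C - U))))"
    by (simp add: sum_distrib_left set_Diff_commute mult_ac)
  also have "\<dots> = (real k + 1) * A"
    unfolding sum_forests A_def by (simp add: sum_distrib_left mult_ac)
  finally have "(\<Sum>U\<in>Pow V. of_bool (r \<notin> U) * (t U * forests (Suc k) (V - U))) = (real k + 1) * A" .
  moreover have "(\<Sum>U\<in>Pow V. t U * forests (Suc k) (V - U))
     = A + (\<Sum>U\<in>Pow V. of_bool (r \<notin> U) * (t U * forests (Suc k) (V - U)))"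
    unfolding A_def sum.distrib[symmetric] by (intro sum.cong refl) auto
  ultimately have "(real k + 2) * forests (Suc (Suc k)) V = (real k + 2) * A"
    using sum_forests[of "Suc k" V] by (simp add: algebra_simps)
  then have "forests (Suc (Suc k)) V = A"
    by (subst (asm) mult_cancel_left) auto
  then show ?case by (simp add: A_def)
qed

text \<open>The component sizes of a forest add up to |V|; formally, \<open>forests_root\<close> is
  summed over all \<open>r\<close>.\<close>

lemma sum_forests_size:
  assumes V: "finite V"
  shows "(\<Sum>U\<in>Pow V. real (card U) * (t U * forests k (V - U))) = real (card V) * forests (Suc k) V"
proof -
  have "real (card V) * forests (Suc k) V = (\<Sum>r\<in>V. \<Sum>U\<in>Pow V. of_bool (r \<in> U) * (t U * forests k (V - U)))"
    using forests_root[OF V] by simp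
  also have "\<dots> = (\<Sum>U\<in>Pow V. (\<Sum>r\<in>V. of_bool (r \<in> U) * 1) * (t U * forests k (V - U)))"
    by (subst sum.swap) (simp add: sum_distrib_right)
  also have "\<dots> = (\<Sum>U\<in>Pow V. real (card U) * (t U * forests k (V - U)))"
  proof (intro sum.cong refl arg_cong2[where f="(*)"])
    fix U assume "U \<in> Pow V"
    then show "(\<Sum>r\<in>V. of_bool (r \<in> U) * 1) = real (card U)"
      using sum_of_bool_mem[OF V, of U "\<lambda>_. 1"] by simp
  qed
  finally show ?thesis ..
qed

text \<open>Carries a statement about two components filling \<open>U\<close> over to ordered pairs
  of components in forests with \<open>k + 2\<close> components, the other \<open>k\<close> being
  fixed.\<close>

lemma sum_pairs:
  assumes V: "finite V"
  shows "(\<Sum>U\<in>Pow V. forests k (V - U) * (\<Sum>C\<in>Pow U. pairw U C * \<omega> (card C) (card (U - C))))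
    = (\<Sum>C\<in>Pow V. \<Sum>D\<in>Pow (V - C). t C * (t D * forests k (V - C - D)) * \<omega> (card C) (card D))"
proof -
  have "(\<Sum>U\<in>Pow V. forests k (V - U) * (\<Sum>C\<in>Pow U. pairw U C * \<omega> (card C) (card (U - C))))
    = (\<Sum>U\<in>Pow V. \<Sum>C\<in>Pow U. t C * (t (U - C) * forests k (V - C - (U - C))) * \<omega> (card C) (card (U - C)))"
    unfolding sum_distrib_left
  proof (intro sum.cong refl)
    fix U C assume "U \<in> Pow V" "C \<in> Pow U"
    then have "V - C - (U - C) = V - U" by auto
    then show "forests k (V - U) * (pairw U C * \<omega> (card C) (card (U - C)))
      = t C * (t (U - C) * forests k (V - C - (U - C))) * \<omega> (card C) (card (U - C))"
      by (simp add: pairw_def)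
  qed
  also have "\<dots> = (\<Sum>C\<in>Pow V. \<Sum>D\<in>Pow (V - C). t C * (t D * forests k (V - C - D)) * \<omega> (card C) (card D))"
    by (rule sum_Pow_Pow[OF V])
  finally show ?thesis .
qed

text \<open>Once one component of the pair is fixed, the other is any of the remaining
  \<open>k + 1\<close>.\<close>

lemma sum_pairs_sq:
  assumes V: "finite V"
  shows "(\<Sum>C\<in>Pow V. \<Sum>D\<in>Pow (V - C). t C * (t D * forests k (V - C - D)) * (real (card C))\<^sup>2) = (real k + 1) * sqsum (Suc k) V"
    and "(\<Sum>C\<in>Pow V. \<Sum>D\<in>Pow (V - C). t C * (t D * forests k (V - C - D)) * (real (card D))\<^sup>2) = (real k + 1) * sqsum (Suc k) V"
proof -
  have "(\<Sum>C\<in>Pow V. \<Sum>D\<in>Pow (V - C). t C * (t D * forests k (V - C - D)) * (real (card C))\<^sup>2)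
    = (\<Sum>C\<in>Pow V. (real (card C))\<^sup>2 * t C * (\<Sum>D\<in>Pow (V - C). t D * forests k (V - C - D)))"
    by (simp add: sum_distrib_left mult_ac)
  then show 1: "(\<Sum>C\<in>Pow V. \<Sum>D\<in>Pow (V - C). t C * (t D * forests k (V - C - D)) * (real (card C))\<^sup>2) = (real k + 1) * sqsum (Suc k) V"
    unfolding sum_forests sqsum_def by (simp add: sum_distrib_left mult_ac)
  have "(\<Sum>C\<in>Pow V. \<Sum>D\<in>Pow (V - C). t C * (t D * forests k (V - C - D)) * (real (card D))\<^sup>2)
    = (\<Sum>D\<in>Pow V. \<Sum>C\<in>Pow (V - D). t C * (t D * forests k (V - C - D)) * (real (card D))\<^sup>2)"
    by (rule sum_Pow_swap[OF V])
  also have "\<dots> = (\<Sum>C\<in>Pow V. \<Sum>D\<in>Pow (V - C). t C * (t D * forests k (V - C - D)) * (real (card C))\<^sup>2)"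
    by (simp add: set_Diff_commute mult_ac)
  finally show "(\<Sum>C\<in>Pow V. \<Sum>D\<in>Pow (V - C). t C * (t D * forests k (V - C - D)) * (real (card D))\<^sup>2) = (real k + 1) * sqsum (Suc k) V"
    using 1 by simp
qed

text \<open>Next to a component of size \<open>c\<close> the other sizes add up to
  \<open>n - c\<close>, so the products over ordered pairs add up to \<open>n^2\<close> minus the
  sum of squares.\<close>

lemma sum_pairs_prod:
  assumes V: "finite V"
  shows "(\<Sum>C\<in>Pow V. \<Sum>D\<in>Pow (V - C). t C * (t D * forests k (V - C - D)) * (real (card C) * real (card D)))
    = (real (card V))\<^sup>2 * forests (k + 2) V - sqsum (Suc k) V"
proof -
  have "(\<Sum>C\<in>Pow V. \<Sum>D\<in>Pow (V - C). t C * (t D * forests k (V - C - D)) * (real (card C) * real (card D)))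
    = (\<Sum>C\<in>Pow V. real (card C) * t C * (\<Sum>D\<in>Pow (V - C). real (card D) * (t D * forests k (V - C - D))))"
    by (simp add: sum_distrib_left mult_ac)
  also have "\<dots> = (\<Sum>C\<in>Pow V. real (card C) * t C * ((real (card V) - real (card C)) * forests (Suc k) (V - C)))"
  proof (intro sum.cong refl arg_cong2[where f="(*)"])
    fix C assume "C \<in> Pow V"
    then have "real (card (V - C)) = real (card V) - real (card C)"
      using V by (auto simp: card_Diff_subset finite_subset card_mono of_nat_diff)
    then show "(\<Sum>D\<in>Pow (V - C). real (card D) * (t D * forests k (V - C - D))) = (real (card V) - real (card C)) * forests (Suc k) (V - C)"
      using sum_forests_size[of "V - C" k] V by simp
  qed
  also have "\<dots> = real (card V) * (\<Sum>C\<in>Pow V. real (card C) * (t C * forests (Suc k) (V - C))) - sqsum (Suc k) V"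
    unfolding sqsum_def sum_distrib_left sum_subtractf[symmetric]
    by (intro sum.cong refl) (simp add: power2_eq_square algebra_simps)
  also have "\<dots> = (real (card V))\<^sup>2 * forests (k + 2) V - sqsum (Suc k) V"
    unfolding sum_forests_size[OF V] by (simp add: power2_eq_square)
  finally show ?thesis .
qed

section \<open>The two linear inequalities between consecutive levels\<close>

lemma complete_on_subset: "complete_on V \<Longrightarrow> U \<subseteq> V \<Longrightarrow> complete_on U"
  by (auto simp: complete_on_def)

text \<open>Induction attaching \<open>x\<close> as a leaf: the term \<open>B = V - {x}\<close> of
  \<open>t_branch'\<close> is already positive.\<close>

lemma complete_pos:
  assumes "finite V" "V \<noteq> {}" "complete_on V"
  shows "t V > 0"
  using assms
proof (induction "card V" arbitrary: V rule: less_induct)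
  case less
  obtain x where x: "x \<in> V" using less.prems by auto
  show ?case
  proof (cases "V = {x}")
    case True
    then show ?thesis by (simp add: t_sing)
  next
    case False
    then obtain z where z: "z \<in> V" "z \<noteq> x" using x by blast
    have tz: "t (V - {x}) > 0"
    proof (rule less.hyps)
      show "card (V - {x}) < card V" using x less.prems by (intro psubset_card_mono) auto
    qed (use x z less.prems complete_on_subset[of V "V - {x}"] in auto)
    have "(\<Sum>w\<in>V - {x}. a x w) > 0"
      by (rule sum_pos2[of _ z]) (use z x less.prems a_nonneg in \<open>auto simp: complete_on_def\<close>)
    then have "0 < of_bool (z \<in> V - {x}) * of_bool (x \<notin> V - {x}) * (deg x (V - {x}) * t (V - {x}) * t (V - (V - {x})))"
      using tz z x by (simp add: deg_def double_diff t_sing)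
    also have "\<dots> \<le> t V"
      unfolding t_branch'[OF less.prems(1) x z(1) z(2)[symmetric]]
      by (rule member_le_sum)
        (use less.prems in \<open>auto intro!: mult_nonneg_nonneg t_nonneg sum_nonneg a_nonneg simp: deg_def\<close>)
    finally show ?thesis .
  qed
qed

text \<open>\<open>two_forests\<close> is applied to the union \<open>U\<close> of two components
  while the other \<open>k\<close> stay fixed. The squares contribute \<open>2 (k + 1)\<close>
  copies of \<open>sqsum (Suc k) V\<close>, and the products contribute one more.\<close>

lemma level_A:
  fixes k :: nat
  assumes V: "finite V"
  defines "n \<equiv> real (card V)"
  defines "L \<equiv> (2 * real k + 3) * sqsum (Suc k) V - n\<^sup>2 * forests (k + 2) V"
  defines "R \<equiv> sqsum k V - n * forests (Suc k) V"
  shows "R \<le> L" and "complete_on V \<Longrightarrow> L = R"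
proof -
  define Q where "Q U = (\<Sum>C\<in>Pow U. pairw U C * ((real (card C))\<^sup>2 - real (card C) * real (card (U - C)) + (real (card (U - C)))\<^sup>2))" for U
  have L: "L = (\<Sum>U\<in>Pow V. forests k (V - U) * Q U)"
    unfolding Q_def sum_pairs[OF V, of k "\<lambda>c d. (real c)\<^sup>2 - real c * real d + (real d)\<^sup>2"]
    unfolding distrib_left right_diff_distrib sum.distrib sum_subtractf sum_pairs_sq[OF V] sum_pairs_prod[OF V]
    by (simp add: L_def n_def algebra_simps)
  have R: "R = (\<Sum>U\<in>Pow V. forests k (V - U) * (real (card U) * (real (card U) - 1) * t U))"
    unfolding R_def n_def sqsum_def sum_forests_size[OF V, symmetric] sum_subtractf[symmetric]
    by (intro sum.cong refl) (simp add: power2_eq_square algebra_simps)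
  have fin: "finite U" if "U \<in> Pow V" for U using that V finite_subset by auto
  show "R \<le> L"
    unfolding L R by (intro sum_mono mult_left_mono forests_nonneg) (use two_forests(1) fin in \<open>auto simp: Q_def\<close>)
  assume K: "complete_on V"
  show "L = R"
    unfolding L R
  proof (intro sum.cong refl arg_cong2[where f="(*)"])
    fix U assume U: "U \<in> Pow V"
    show "Q U = real (card U) * (real (card U) - 1) * t U"
    proof (cases "U = {}")
      case False
      have "complete_on U" using K U complete_on_subset by blast
      then show ?thesis
        unfolding Q_def using two_forests(2)[OF fin[OF U]] complete_pos[OF fin[OF U] False] by simp
    qed (simp add: Q_def)
  qed
qed

lemma cut_le:
  assumes "finite C" "finite D"
  shows "cut C D \<le> real (card C) * real (card D)"
proof -
  have "cut C D \<le> (\<Sum>x\<in>C. \<Sum>w\<in>D. 1)"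
    unfolding cut_def deg_def by (intro sum_mono a_le_1)
  then show ?thesis by simp
qed

text \<open>By \<open>t_edges\<close>, \<open>R\<close> sums \<open>cut C D\<close> over ordered
  pairs of components, that is, counts twice the edges of forests with \<open>k + 1\<close>
  components; \<open>L\<close> sums |C| |D| over the same pairs. For \<open>k = 0\<close>, a split
  separating two vertices joined with weight below 1 makes one term strict.\<close>

lemma level_B:
  fixes k :: nat
  assumes V: "finite V"
  defines "n \<equiv> real (card V)"
  defines "L \<equiv> n\<^sup>2 * forests (k + 2) V - sqsum (Suc k) V"
  defines "R \<equiv> 2 * (n - real k - 1) * forests (Suc k) V"
  shows "R \<le> L" and "complete_on V \<Longrightarrow> L = R"
    and "\<lbrakk>k = 0; t V > 0; x \<in> V; y \<in> V; x \<noteq> y; a x y < 1\<rbrakk> \<Longrightarrow> R < L"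
proof -
  have fin: "finite U" if "U \<in> Pow V" for U using that V finite_subset by auto
  have L: "L = (\<Sum>U\<in>Pow V. forests k (V - U) * (\<Sum>C\<in>Pow U. pairw U C * (real (card C) * real (card (U - C)))))"
    unfolding sum_pairs[OF V, of k "\<lambda>c d. real c * real d"] sum_pairs_prod[OF V] L_def n_def ..
  have R: "R = (\<Sum>U\<in>Pow V. forests k (V - U) * (\<Sum>C\<in>Pow U. pairw U C * cut C (U - C)))"
  proof -
    have "R = 2 * ((\<Sum>U\<in>Pow V. real (card U) * (t U * forests k (V - U))) - (\<Sum>U\<in>Pow V. t U * forests k (V - U)))"
      unfolding sum_forests_size[OF V] sum_forests R_def n_def by (simp add: algebra_simps)
    also have "\<dots> = (\<Sum>U\<in>Pow V. forests k (V - U) * (2 * (real (card U) - 1) * t U))"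
      unfolding sum_subtractf[symmetric] sum_distrib_left by (intro sum.cong refl) (simp add: algebra_simps)
    also have "\<dots> = (\<Sum>U\<in>Pow V. forests k (V - U) * (\<Sum>C\<in>Pow U. pairw U C * cut C (U - C)))"
      by (intro sum.cong refl arg_cong2[where f="(*)"]) (use t_edges fin in \<open>auto simp: pairw_def\<close>)
    finally show ?thesis .
  qed
  have cut: "pairw U C * cut C (U - C) \<le> pairw U C * (real (card C) * real (card (U - C)))" if "U \<in> Pow V" "C \<in> Pow U" for U C
    by (intro mult_left_mono pairw_nonneg cut_le) (use that fin in auto)
  show "R \<le> L"
    unfolding L R by (intro sum_mono mult_left_mono forests_nonneg cut)
  show "L = R" if K: "complete_on V"
    unfolding L R
  proof (intro sum.cong refl arg_cong2[where f="(*)"])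
    fix U C assume UC: "U \<in> Pow V" "C \<in> Pow U"
    have "cut C (U - C) = (\<Sum>x\<in>C. \<Sum>w\<in>U - C. 1)"
      unfolding cut_def deg_def
    proof (intro sum.cong refl)
      fix x w assume "x \<in> C" "w \<in> U - C"
      then have "x \<in> V" "w \<in> V" "x \<noteq> w" using UC by auto
      then show "a x w = 1" using K by (simp add: complete_on_def)
    qed
    then show "real (card C) * real (card (U - C)) = cut C (U - C)" by simp
  qed
  show "R < L" if k: "k = 0" and T: "t V > 0" and xy: "x \<in> V" "y \<in> V" "x \<noteq> y" "a x y < 1"
  proof -
    have L0: "L = (\<Sum>C\<in>Pow V. pairw V C * (real (card C) * real (card (V - C))))"
      unfolding L k by (subst mult.commute) (rule sum_full[OF V])
    have R0: "R = (\<Sum>C\<in>Pow V. pairw V C * cut C (V - C))"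
      unfolding R k by (subst mult.commute) (rule sum_full[OF V])
    \<comment> \<open>Such a split carries positive weight: otherwise every term of
      \<open>t_branch'\<close> for \<open>x\<close> and \<open>y\<close> would vanish.\<close>
    have "\<exists>C\<in>Pow V. y \<in> C \<and> x \<notin> C \<and> pairw V C > 0"
    proof (rule ccontr)
      assume no: "\<not> ?thesis"
      have "pairw V C = 0" if "C \<in> Pow V" "y \<in> C" "x \<notin> C" for C
      proof -
        have "\<not> pairw V C > 0" using no that by blast
        then show ?thesis using pairw_nonneg[of V C] by simp
      qed
      then have "t V = 0"
        unfolding t_branch'[OF V xy(1,2,3)] by (intro sum.neutral ballI) (auto simp: pairw_def)
      then show False using T by simp
    qed
    then obtain C where C: "C \<in> Pow V" "y \<in> C" "x \<notin> C" "pairw V C > 0" by auto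
    have "cut C (V - C) < (\<Sum>z\<in>C. \<Sum>w\<in>V - C. 1)"
      unfolding cut_def
    proof (rule sum_strict_mono_ex1)
      show "\<forall>z\<in>C. deg z (V - C) \<le> (\<Sum>w\<in>V - C. 1)" by (simp add: deg_def) (metis (no_types, lifting) a_le_1 card_eq_sum of_nat_1 of_nat_sum sum_mono)
      have "deg y (V - C) < (\<Sum>w\<in>V - C. 1)"
        unfolding deg_def
      proof (rule sum_strict_mono_ex1)
        show "\<exists>w\<in>V - C. a y w < 1" using C xy by (intro bexI[of _ x]) (auto simp: a_sym[of y x])
      qed (use V a_le_1 in auto)
      then show "\<exists>z\<in>C. deg z (V - C) < (\<Sum>w\<in>V - C. 1)" using C by blast
    qed (use C fin in auto)
    then have "pairw V C * cut C (V - C) < pairw V C * (real (card C) * real (card (V - C)))"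
      using C by simp
    then show ?thesis
      unfolding L0 R0
    proof (intro sum_strict_mono_ex1)
      show "\<exists>C\<in>Pow V. pairw V C * cut C (V - C) < pairw V C * (real (card C) * real (card (V - C)))"
        using \<open>pairw V C * _ < _\<close> C(1) by blast
    qed (use V cut[of V] in auto)
  qed
qed

end

section \<open>Combining the levels\<close>

text \<open>
  In step \<open>i\<close>, for \<open>k = n - i\<close>, the number of forests with at least \<open>k\<close> components is at least
  \<open>X N\<^sub>k + Y S\<^sub>k\<close>; this expression is \<open>A / 2\<close> times the left hand side of \<open>level_A\<close> plus \<open>B / 2\<close> times
  that of \<open>level_B\<close>.
\<close>

primrec mult_seq :: "real \<Rightarrow> nat \<Rightarrow> real \<times> real" where
  "mult_seq n 0 = (1, 0)"
| "mult_seq n (Suc i) = (let (X, Y) = mult_seq n i; A = (X + n\<^sup>2 * Y) / (n\<^sup>2 * (n - real i - 1)); B = A + 2 * X / n\<^sup>2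
     in (1 - A * n / 2 + B * (real i + 1), A / 2))"

text \<open>At the last level \<open>forests 1 V\<close> is \<open>t V\<close> and
  \<open>sqsum 0 V\<close> is \<open>n^2 * t V\<close>, so this is the total factor of
  \<open>t V\<close>.\<close>

definition ratio :: "nat \<Rightarrow> real" where
  "ratio n = fst (mult_seq n (n - 1)) + (real n)\<^sup>2 * snd (mult_seq n (n - 1))"

text \<open>Ensures that the multipliers in \<open>level_step\<close> have the right sign, which
  rests on \<open>0 \<le> Y\<close> and \<open>1 / 2 \<le> X\<close>. The bound 4 on the combined
  value closes the induction.\<close>

lemma mult_seq_bounds:
  assumes "i + 2 \<le> n" and "mult_seq n i = (X, Y)"
  shows "0 \<le> Y \<and> (real n)\<^sup>2 * Y \<le> 1 \<and> 1 / 2 \<le> X \<and> X + (real n)\<^sup>2 * Y \<le> 4"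
  using assms
proof (induction i arbitrary: X Y)
  case (Suc i)
  define r where "r = real n"
  have r: "r \<ge> real i + 3" using Suc.prems(1) by (simp add: r_def)
  then have r0: "r > 0" "r \<ge> 3" by auto
  obtain X0 Y0 where XY0: "mult_seq n i = (X0, Y0)" by (cases "mult_seq n i")
  have IH: "0 \<le> Y0" "r\<^sup>2 * Y0 \<le> 1" "1 / 2 \<le> X0" "X0 + r\<^sup>2 * Y0 \<le> 4"
    using Suc.IH[OF _ XY0] Suc.prems(1) by (auto simp: r_def)
  define k where "k = r - real i"
  have k: "k \<ge> 3" "k \<le> r" using r by (auto simp: k_def)
  \<comment> \<open>This is \<open>r^2 * A\<close>; it is at most 2 because the numerator is at most
    4 and \<open>k \<ge> 3\<close>.\<close>
  define \<alpha> where "\<alpha> = (X0 + r\<^sup>2 * Y0) / (k - 1)"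
  have ak: "\<alpha> * (k - 1) = X0 + r\<^sup>2 * Y0" using k by (simp add: \<alpha>_def)
  have "r\<^sup>2 * Y0 \<ge> 0" using IH by simp
  then have \<alpha>0: "\<alpha> \<ge> 0" using IH k by (simp add: \<alpha>_def)
  have \<alpha>2: "\<alpha> \<le> 2"
  proof -
    have "\<alpha> * 2 \<le> \<alpha> * (k - 1)" using \<alpha>0 k by (intro mult_left_mono) auto
    then show ?thesis using ak IH(4) by simp
  qed
  define A where "A = (X0 + r\<^sup>2 * Y0) / (r\<^sup>2 * (k - 1))"
  have A: "A = \<alpha> / r\<^sup>2" by (simp add: A_def \<alpha>_def)
  define B where "B = A + 2 * X0 / r\<^sup>2"
  have B: "B = (\<alpha> + 2 * X0) / r\<^sup>2" by (simp add: B_def A add_divide_distrib)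
  have XY: "X = 1 - A * r / 2 + B * (real i + 1)" "Y = A / 2"
    using Suc.prems(2) XY0 unfolding r_def[symmetric] by (simp_all add: Let_def A_def B_def k_def)
  have Y: "r\<^sup>2 * Y = \<alpha> / 2" using r0 by (simp add: XY A)
  have B0: "B \<ge> 0" using \<alpha>0 IH by (simp add: B)
  have Ar: "A * r = \<alpha> / r" using r0 by (simp add: A power2_eq_square)
  have "\<alpha> / r \<le> 2 / 3" using \<alpha>0 \<alpha>2 r0 by (intro frac_le) auto
  moreover have "B * (real i + 1) \<ge> 0" using B0 by simp
  ultimately have X: "X \<ge> 1 / 2" unfolding XY(1) using Ar by linarith
  have "X0 \<le> \<alpha> * (k - 1)" using ak \<open>r\<^sup>2 * Y0 \<ge> 0\<close> by simp
  then have "\<alpha> + 2 * X0 \<le> \<alpha> * (2 * k - 1)" by (simp add: algebra_simps)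
  also have "\<dots> \<le> 2 * (2 * k - 1)" using \<alpha>2 k by (intro mult_right_mono) auto
  finally have "(\<alpha> + 2 * X0) * (r - k + 1) \<le> 2 * (2 * k - 1) * (r - k + 1)"
    using k by (intro mult_right_mono) auto
  \<comment> \<open>The factors \<open>2 * k - 1\<close> and \<open>2 * (r - k + 1)\<close> have sum
    \<open>2 * r + 1\<close>, so their product is at most the square of half that sum.\<close>
  also have "\<dots> \<le> (r + 1 / 2)\<^sup>2"
  proof -
    have "0 \<le> (r + 1 / 2 - (2 * k - 1))\<^sup>2" by simp
    then show ?thesis by (simp add: power2_eq_square algebra_simps)
  qed
  also have "\<dots> \<le> 2 * r\<^sup>2"
  proof -
    have "r * r \<ge> 3 * r" using r0 by (intro mult_right_mono) auto
    then have "r + 1 / 4 \<le> r * r" using r0 by linarith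
    then show ?thesis by (simp add: power2_eq_square algebra_simps)
  qed
  finally have "B * (real i + 1) \<le> 2"
    using r0 by (simp add: B k_def divide_le_eq)
  moreover have "\<alpha> / r \<ge> 0" using \<alpha>0 r0 by simp
  ultimately have "X + r\<^sup>2 * Y \<le> 4"
    unfolding Y unfolding XY(1) using Ar \<alpha>2 by linarith
  then show ?case
    using X Y \<alpha>0 \<alpha>2 A XY(2) r0 by (auto simp: r_def[symmetric])
qed auto

section \<open>Descent from isolated vertices to trees\<close>

context tree_weights begin

text \<open>A combination of \<open>level_A\<close> and \<open>level_B\<close> with multipliers
  \<open>A / 2\<close> and \<open>B / 2\<close>. The coefficient is \<open>X' - 1\<close> because
  \<open>X'\<close> also includes the forests with \<open>k + 1\<close> components themselves.
  Strictness survives because \<open>B > 0\<close>.\<close>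

lemma level_step:
  fixes k :: nat
  assumes V: "finite V" and n: "n = card V" and k: "k + 2 \<le> n"
    and seq: "mult_seq n (n - k - 2) = (X, Y)" "mult_seq n (n - k - 1) = (X', Y')"
  defines "L \<equiv> X * forests (k + 2) V + Y * sqsum (k + 1) V"
  defines "R \<equiv> (X' - 1) * forests (k + 1) V + Y' * sqsum k V"
  shows "R \<le> L" and "complete_on V \<Longrightarrow> L = R"
    and "\<lbrakk>k = 0; t V > 0; x \<in> V; y \<in> V; x \<noteq> y; a x y < 1\<rbrakk> \<Longrightarrow> R < L"
proof -
  define r where "r = real n"
  have r: "r > 0" using k by (simp add: r_def)
  define A where "A = (X + r\<^sup>2 * Y) / (r\<^sup>2 * (real k + 1))"
  define B where "B = A + 2 * X / r\<^sup>2"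
  have XY: "0 \<le> Y" "1 / 2 \<le> X"
    using mult_seq_bounds[OF _ seq(1)] k by auto
  have A0: "A \<ge> 0" using XY by (simp add: A_def)
  have "X / r\<^sup>2 > 0" using XY r by simp
  then have B0: "B > 0" using A0 by (simp add: B_def)
  define i where "i = n - k - 2"
  have nk: "n - k - 1 = Suc i" using k by (simp add: i_def)
  have rk: "real i = r - real k - 2" using k by (simp add: r_def i_def of_nat_diff)
  have XY': "X' = 1 - A * r / 2 + B * (r - real k - 1)" "Y' = A / 2"
    using seq unfolding nk r_def[symmetric] i_def[symmetric] by (simp_all add: Let_def rk A_def B_def add.commute)
  define LA where "LA = (2 * real k + 3) * sqsum (Suc k) V - r\<^sup>2 * forests (k + 2) V"
  define LB where "LB = r\<^sup>2 * forests (k + 2) V - sqsum (Suc k) V"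
  define RA where "RA = sqsum k V - r * forests (Suc k) V"
  define RB where "RB = 2 * (r - real k - 1) * forests (Suc k) V"
  have R: "R = A / 2 * RA + B / 2 * RB"
    by (simp add: R_def XY' RA_def RB_def algebra_simps)
  \<comment> \<open>This equation and \<open>cY\<close> match the coefficients of
    \<open>forests (k + 2) V\<close> and \<open>sqsum (k + 1) V\<close>; together they determine
    \<open>A\<close> and \<open>B\<close>.\<close>
  have cX: "r\<^sup>2 * (B - A) / 2 = X" using r by (simp add: B_def)
  have cY: "(A * (2 * real k + 3) - B) / 2 = Y"
  proof -
    have "A * (real k + 1) = X / r\<^sup>2 + Y"
    proof -
      have "A * (real k + 1) = (X + r\<^sup>2 * Y) / r\<^sup>2" by (simp add: A_def)
      then show ?thesis using r by (simp add: add_divide_distrib)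
    qed
    moreover have "X / r\<^sup>2 = (B - A) / 2" by (simp add: B_def)
    ultimately show ?thesis by (simp add: field_simps)
  qed
  have L: "L = A / 2 * LA + B / 2 * LB"
    unfolding L_def LA_def LB_def cX[symmetric] cY[symmetric] by (simp add: field_simps)
  note lA = level_A[OF V, of k, folded n, folded r_def, folded LA_def RA_def]
  note lB = level_B[OF V, of k, folded n, folded r_def, folded LB_def RB_def]
  show "R \<le> L"
    unfolding R L using A0 B0 lA(1) lB(1) by (intro add_mono mult_left_mono) auto
  show "complete_on V \<Longrightarrow> L = R"
    unfolding R L using lA(2) lB(2) by simp
  show "R < L" if "k = 0" "t V > 0" "x \<in> V" "y \<in> V" "x \<noteq> y" "a x y < 1"
    unfolding R L using A0 B0 lA(1) lB(3)[OF that] by (intro add_le_less_mono mult_left_mono mult_strict_left_mono) auto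
qed

text \<open>Starting from forests with \<open>n\<close> components, each step adds the next lower
  level and applies \<open>level_step\<close> to the bound found so far. Strictness is claimed only
  on reaching one component, where \<open>level_B\<close> supplies it.\<close>

lemma sum_levels:
  assumes V: "finite V" and n: "n = card V" and i: "i + 1 \<le> n"
    and seq: "mult_seq n i = (X, Y)"
  defines "L \<equiv> (\<Sum>j=n - i..n. forests j V)"
  defines "R \<equiv> X * forests (n - i) V + Y * sqsum (n - i - 1) V"
  shows "R \<le> L \<and> (complete_on V \<longrightarrow> L = R) \<and>
    (n - i = 1 \<longrightarrow> t V > 0 \<longrightarrow> (\<exists>x\<in>V. \<exists>y\<in>V. x \<noteq> y \<and> a x y < 1) \<longrightarrow> R < L)"
  using i seq unfolding L_def R_def
proof (induction i arbitrary: X Y)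
  case 0
  \<comment> \<open>For \<open>n = 1\<close> the descent has no step, and strictness is vacuous as
    there is only one vertex.\<close>
  have "\<not> (\<exists>x\<in>V. \<exists>y\<in>V. x \<noteq> y \<and> a x y < 1)" if "n = 1"
  proof -
    obtain v where "V = {v}" using \<open>n = 1\<close> n by (auto simp: card_1_singleton_iff)
    then show ?thesis by auto
  qed
  then show ?case using 0 by auto
next
  case (Suc i)
  obtain X0 Y0 where XY0: "mult_seq n i = (X0, Y0)" by (cases "mult_seq n i")
  define k where "k = n - i - 2"
  have k: "n - i = k + 2" "n - Suc i = k + 1" "n - k - 2 = i" "n - k - 1 = Suc i" "k + 2 \<le> n"
    using Suc.prems by (auto simp: k_def)
  have split: "(\<Sum>j=n - Suc i..n. forests j V) = forests (k + 1) V + (\<Sum>j=n - i..n. forests j V)"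
    using k by (simp add: sum.atLeast_Suc_atMost)
  note IH = Suc.IH[OF _ XY0]
  have IH1: "X0 * forests (k + 2) V + Y0 * sqsum (k + 1) V \<le> (\<Sum>j=n - i..n. forests j V)"
    and IH2: "complete_on V \<Longrightarrow> (\<Sum>j=n - i..n. forests j V) = X0 * forests (k + 2) V + Y0 * sqsum (k + 1) V"
    using IH Suc.prems(1) by (auto simp: k)
  note step = level_step[OF V n k(5), unfolded k(3,4), OF XY0 Suc.prems(2)]
  have eq: "X * forests (k + 1) V + Y * sqsum k V = forests (k + 1) V + ((X - 1) * forests (k + 1) V + Y * sqsum k V)"
    by (simp add: algebra_simps)
  have "X * forests (k + 1) V + Y * sqsum k V \<le> forests (k + 1) V + (\<Sum>j=n - i..n. forests j V)"
    unfolding eq using step(1) IH1 by linarith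
  moreover have "forests (k + 1) V + (\<Sum>j=n - i..n. forests j V) = X * forests (k + 1) V + Y * sqsum k V" if "complete_on V"
    unfolding eq using step(2)[OF that] IH2[OF that] by linarith
  moreover have "X * forests (k + 1) V + Y * sqsum k V < forests (k + 1) V + (\<Sum>j=n - i..n. forests j V)"
    if "k = 0" "t V > 0" "\<exists>x\<in>V. \<exists>y\<in>V. x \<noteq> y \<and> a x y < 1"
  proof -
    obtain x y where "x \<in> V" "y \<in> V" "x \<noteq> y" "a x y < 1" using \<open>\<exists>x\<in>V. _\<close> by blast
    from step(3)[OF that(1,2) this] IH1 show ?thesis unfolding eq by linarith
  qed
  ultimately show ?case unfolding split unfolding k(2) add_diff_cancel_right' by auto
qed

text \<open>\<open>F\<close> enters only through the recursion over the component of a vertex, which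
  identifies it with the sum of all levels; \<open>sum_levels\<close> is then used at its last index
  \<open>n - 1\<close>.\<close>

theorem forests_trees_ratio:
  assumes V: "finite V" "V \<noteq> {}"
    and F_empty: "F {} = 1"
    and F_root: "\<And>U r. \<lbrakk>U \<subseteq> V; r \<in> U\<rbrakk> \<Longrightarrow> F U = (\<Sum>C\<in>Pow U. of_bool (r \<in> C) * (t C * F (U - C)))"
  shows "ratio (card V) * t V \<le> F V"
    and "complete_on V \<Longrightarrow> F V = ratio (card V) * t V"
    and "\<lbrakk>t V > 0; x \<in> V; y \<in> V; x \<noteq> y; a x y < 1\<rbrakk> \<Longrightarrow> ratio (card V) * t V < F V"
proof -
  \<comment> \<open>Induction on the bound \<open>m\<close>: removing the component of
    \<open>r\<close> makes the vertex set smaller, and \<open>forests_root\<close> raises the level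
    by one.\<close>
  have F: "F U = (\<Sum>j\<le>m. forests j U)" if "U \<subseteq> V" "card U \<le> m" for U m
    using that
  proof (induction m arbitrary: U)
    case 0
    then have "U = {}" using V finite_subset by fastforce
    then show ?case by (simp add: F_empty)
  next
    case (Suc m)
    have fU: "finite U" using Suc.prems V finite_subset by blast
    show ?case
    proof (cases "U = {}")
      case True
      have "(\<Sum>j\<le>Suc m. forests j ({} :: 'a set)) = 1"
        by (subst sum.atMost_Suc_shift) (simp add: forests_zero)
      then show ?thesis using True F_empty by simp
    next
      case False
      then obtain r where r: "r \<in> U" by auto
      have "F U = (\<Sum>C\<in>Pow U. of_bool (r \<in> C) * (t C * (\<Sum>j\<le>m. forests j (U - C))))"
        unfolding F_root[OF Suc.prems(1) r]
      proof (rule sum.cong[OF refl])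
        fix C assume C: "C \<in> Pow U"
        show "of_bool (r \<in> C) * (t C * F (U - C)) = of_bool (r \<in> C) * (t C * (\<Sum>j\<le>m. forests j (U - C)))"
        proof (cases "r \<in> C")
          case True
          then have "card (U - C) < card U"
            using r C fU by (intro psubset_card_mono) auto
          then show ?thesis using Suc.IH[of "U - C"] Suc.prems by auto
        qed simp
      qed
      also have "\<dots> = (\<Sum>j\<le>m. \<Sum>C\<in>Pow U. of_bool (r \<in> C) * (t C * forests j (U - C)))"
        by (subst sum.swap) (simp add: sum_distrib_left)
      also have "\<dots> = (\<Sum>j\<le>Suc m. forests j U)"
        using False by (simp add: forests_root[OF fU r] sum.atMost_Suc_shift del: sum.atMost_Suc)
      finally show ?thesis .
    qed
  qed
  define n where "n = card V"
  have n: "n > 0" using V by (simp add: n_def card_gt_0_iff)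
  obtain X Y where XY: "mult_seq n (n - 1) = (X, Y)" by (cases "mult_seq n (n - 1)")
  have "F V = (\<Sum>j=0..n. forests j V)" using F[of V n] by (simp add: n_def atMost_atLeast0)
  \<comment> \<open>Level 0 vanishes because \<open>V\<close> is nonempty.\<close>
  also have "\<dots> = (\<Sum>j=1..n. forests j V)"
    using V by (simp add: sum.atLeast_Suc_atMost[of 0 n])
  finally have FV: "F V = (\<Sum>j=1..n. forests j V)" .
  have R: "ratio (card V) * t V = X * forests 1 V + Y * sqsum 0 V"
    using forests_1[OF V(1)] sqsum_0[OF V(1)] XY by (simp add: ratio_def n_def algebra_simps)
  have n1: "n - (n - 1) = 1" "n - 1 + 1 \<le> n" using n by auto
  note main = sum_levels[OF V(1) n_def n1(2) XY, unfolded n1(1) diff_self_eq_0, folded FV R]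
  show "ratio (card V) * t V \<le> F V" "complete_on V \<Longrightarrow> F V = ratio (card V) * t V"
    and "\<lbrakk>t V > 0; x \<in> V; y \<in> V; x \<noteq> y; a x y < 1\<rbrakk> \<Longrightarrow> ratio (card V) * t V < F V"
    using main by auto
qed

end

section \<open>Spanning trees and forests of a finite graph\<close>

definition conn :: "'a set set \<Rightarrow> 'a \<Rightarrow> 'a \<Rightarrow> bool" where
  "conn A x y \<longleftrightarrow> (x, y) \<in> (adjacency A)\<^sup>*"

lemma conn_refl [simp]: "conn A x x"
  by (simp add: conn_def)

lemma conn_trans: "conn A x y \<Longrightarrow> conn A y z \<Longrightarrow> conn A x z"
  unfolding conn_def by (rule rtrancl_trans)

lemma conn_sym: "conn A x y \<Longrightarrow> conn A y x"
proof -
  have "sym (adjacency A)"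
    by (auto simp: sym_def adjacency_def insert_commute)
  then show "conn A x y \<Longrightarrow> conn A y x"
    unfolding conn_def using sym_rtrancl by (metis symD)
qed

lemma conn_mono: "conn A x y \<Longrightarrow> A \<subseteq> B \<Longrightarrow> conn B x y"
  unfolding conn_def by (rule subsetD[OF rtrancl_mono]) (auto simp: adjacency_def)

lemma conn_edge: "{x, y} \<in> A \<Longrightarrow> conn A x y"
  by (auto simp: conn_def adjacency_def)

lemma conn_induct [consumes 1, case_names refl step]:
  assumes "conn A x y" and "P x" and "\<And>y z. conn A x y \<Longrightarrow> P y \<Longrightarrow> {y, z} \<in> A \<Longrightarrow> P z"
  shows "P y"
  using assms(1) unfolding conn_def
  by (induction rule: rtrancl_induct) (use assms(2,3) in \<open>auto simp: conn_def adjacency_def\<close>)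

text \<open>A connection needs the new edge at most once; the last two cases are its two
  directions.\<close>

lemma conn_insert:
  assumes "conn (insert {x, w} S) p q"
  shows "conn S p q \<or> (conn S p x \<and> conn S w q) \<or> (conn S p w \<and> conn S x q)"
  using assms
proof (induction rule: conn_induct)
  case (step y z)
  show ?case
  proof (cases "{y, z} = {x, w}")
    case True
    then consider "y = x" "z = w" | "y = w" "z = x" by (auto simp: doubleton_eq_iff)
    then show ?thesis
      using step.IH by cases (auto intro: conn_trans conn_sym)
  next
    case False
    then have "conn S y z" using step.hyps by (auto intro: conn_edge)
    then show ?thesis using step.IH by (meson conn_trans)
  qed
qed simp

text \<open>A walk starting in \<open>B\<close> can never use an edge of \<open>S2\<close>, and the
  edges of \<open>S1\<close> keep it in \<open>B\<close>.\<close>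

lemma conn_within:
  assumes "conn (S1 \<union> S2) p q" "p \<in> B" "\<And>e. e \<in> S1 \<Longrightarrow> e \<subseteq> B" "\<And>e. e \<in> S2 \<Longrightarrow> e \<inter> B = {}"
  shows "q \<in> B \<and> conn S1 p q"
  using assms(1)
proof (induction rule: conn_induct)
  case (step y z)
  then have "{y, z} \<in> S1" using assms(4)[of "{y, z}"] by auto
  then show ?case using step.IH assms(3)[of "{y, z}"] by (auto intro: conn_trans conn_edge)
qed (use assms(2) in simp)

text \<open>Replaces vertex lists by bridges: a set is acyclic when removing any of its edges
  separates the ends. A shortest walk around an edge closes to a cycle, and conversely a cycle
  bypasses its closing edge.\<close>

lemma cycle_free_iff:
  assumes "\<forall>e\<in>A. card e = 2"
  shows "cycle_free A \<longleftrightarrow> (\<forall>x y. {x, y} \<in> A \<longrightarrow> \<not> conn (A - {{x, y}}) x y)"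
proof
  assume cf: "cycle_free A"
  show "\<forall>x y. {x, y} \<in> A \<longrightarrow> \<not> conn (A - {{x, y}}) x y"
  proof (intro allI impI notI)
    fix x y assume xy: "{x, y} \<in> A" and c: "conn (A - {{x, y}}) x y"
    have neq: "x \<noteq> y" using assms xy by force
    define R where "R = adjacency (A - {{x, y}})"
    \<comment> \<open>In a walk of least length no vertex is repeated, since a repetition would
      allow a shortcut.\<close>
    define n where "n = (LEAST n. (x, y) \<in> R ^^ n)"
    have "\<exists>n. (x, y) \<in> R ^^ n" using c by (simp add: conn_def R_def rtrancl_power)
    then have n: "(x, y) \<in> R ^^ n" unfolding n_def by (rule LeastI_ex)
    then obtain f where f: "f 0 = x" "f n = y" "\<And>i. i < n \<Longrightarrow> (f i, f (Suc i)) \<in> R"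
      by (auto simp: relpow_fun_conv)
    have sub: "(f i, f j) \<in> R ^^ (j - i)" if "i \<le> j" "j \<le> n" for i j
      unfolding relpow_fun_conv using that f(3) by (intro exI[of _ "\<lambda>k. f (i + k)"]) auto
    have inj: "f i \<noteq> f j" if "i < j" "j \<le> n" for i j
    proof
      assume eq: "f i = f j"
      have "(x, f i) \<in> R ^^ i" "(f j, y) \<in> R ^^ (n - j)"
        using sub[of 0 i] sub[of j n] f that by auto
      then have "(x, y) \<in> R ^^ (i + (n - j))" using eq by (auto simp: relpow_add)
      then have "n \<le> i + (n - j)" unfolding n_def by (rule Least_le)
      then show False using that by simp
    qed
    \<comment> \<open>Length 1 would be the removed edge itself; thus the cycle has
      \<open>Suc n \<ge> 3\<close> vertices, as \<open>cycle_in\<close> demands.\<close>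
    have n2: "n \<ge> 2"
    proof (rule ccontr)
      assume "\<not> n \<ge> 2"
      then consider "n = 0" | "n = 1" by linarith
      then show False
      proof cases
        case 2
        then have "(x, y) \<in> R" using f(3)[of 0] f by simp
        then show False by (simp add: R_def adjacency_def)
      qed (use f neq in auto)
    qed
    have "cycle_in A (map f [0..<Suc n])"
      unfolding cycle_in_def
    proof (intro conjI allI impI)
      show "3 \<le> length (map f [0..<Suc n])" using n2 by simp
      show "distinct (map f [0..<Suc n])"
      proof -
        have "inj_on f {0..<Suc n}"
        proof (rule inj_onI)
          fix i j assume "i \<in> {0..<Suc n}" "j \<in> {0..<Suc n}" "f i = f j"
          then show "i = j" using inj[of i j] inj[of j i] by (cases i j rule: linorder_cases) auto
        qed
        then show ?thesis by (simp add: distinct_map del: upt_Suc)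
      qed
      fix i assume i: "i < length (map f [0..<Suc n])"
      show "{map f [0..<Suc n] ! i, map f [0..<Suc n] ! (Suc i mod length (map f [0..<Suc n]))} \<in> A"
      proof (cases "i = n")
        case True
        then show ?thesis using f xy by (simp add: insert_commute del: upt_Suc)
      next
        case False
        then have "i < n" using i by simp
        then show ?thesis using f(3)[of i] by (simp add: R_def adjacency_def del: upt_Suc)
      qed
    qed
    then show False using cf by (auto simp: cycle_free_def)
  qed
next
  assume no: "\<forall>x y. {x, y} \<in> A \<longrightarrow> \<not> conn (A - {{x, y}}) x y"
  show "cycle_free A"
    unfolding cycle_free_def
  proof
    assume "\<exists>vs. cycle_in A vs"
    then obtain vs where vs: "length vs \<ge> 3" "distinct vs"
      and edge: "\<And>i. i < length vs \<Longrightarrow> {vs ! i, vs ! (Suc i mod length vs)} \<in> A"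
      by (auto simp: cycle_in_def)
    define m where "m = length vs - 1"
    have m: "length vs = Suc m" "m \<ge> 2" using vs by (auto simp: m_def)
    define e where "e = {vs ! 0, vs ! m}"
    have e: "e \<in> A" using edge[of m] by (simp add: m e_def insert_commute)
    have step: "{vs ! i, vs ! Suc i} \<in> A - {e}" if "i < m" for i
    proof -
      have "{vs ! i, vs ! Suc i} \<in> A" using edge[of i] that m by simp
      moreover have "{vs ! i, vs ! Suc i} \<noteq> e"
        using vs(2) that m by (auto simp: e_def doubleton_eq_iff nth_eq_iff_index_eq)
      ultimately show ?thesis by simp
    qed
    have "conn (A - {e}) (vs ! 0) (vs ! i)" if "i \<le> m" for i
      using that
    proof (induction i)
      case (Suc i)
      then show ?case using step[of i] by (meson Suc_le_eq conn_edge conn_trans less_imp_le)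
    qed simp
    then show False using no e by (auto simp: e_def)
  qed
qed

lemma cycle_free_subset: "cycle_free A \<Longrightarrow> B \<subseteq> A \<Longrightarrow> cycle_free B"
  by (auto simp: cycle_free_def cycle_in_def)

text \<open>Bridges stay bridges: a connection between the ends of an edge remains on its own side,
  by \<open>conn_within\<close> for \<open>B\<close> or for its complement.\<close>

lemma cycle_free_union:
  assumes card: "\<forall>e\<in>A1 \<union> A2. card e = 2"
    and B: "\<And>e. e \<in> A1 \<Longrightarrow> e \<subseteq> B" and C: "\<And>e. e \<in> A2 \<Longrightarrow> e \<inter> B = {}"
    and cf: "cycle_free A1" "cycle_free A2"
  shows "cycle_free (A1 \<union> A2)"
proof -
  have c1: "\<forall>e\<in>A1. card e = 2" and c2: "\<forall>e\<in>A2. card e = 2" using card by auto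
  note n1 = cf(1)[unfolded cycle_free_iff[OF c1]]
  note n2 = cf(2)[unfolded cycle_free_iff[OF c2]]
  have C': "e \<subseteq> - B" if "e \<in> A2" for e using C[OF that] by auto
  have "\<forall>x y. {x, y} \<in> A1 \<union> A2 \<longrightarrow> \<not> conn (A1 \<union> A2 - {{x, y}}) x y"
  proof (intro allI impI notI)
    fix x y assume xy: "{x, y} \<in> A1 \<union> A2" and c: "conn (A1 \<union> A2 - {{x, y}}) x y"
    show False
    proof (cases "{x, y} \<in> A1")
      case True
      have "conn ((A1 - {{x, y}}) \<union> A2) x y" by (rule conn_mono[OF c]) auto
      then have "conn (A1 - {{x, y}}) x y"
        using conn_within[of "A1 - {{x, y}}" A2 x y B] B[OF True] B C by auto
      then show False using n1 True by blast
    next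
      case False
      then have xy2: "{x, y} \<in> A2" using xy by simp
      have "conn ((A2 - {{x, y}}) \<union> A1) x y" by (rule conn_mono[OF c]) auto
      then have "conn (A2 - {{x, y}}) x y"
        using conn_within[of "A2 - {{x, y}}" A1 x y "- B"] C'[OF xy2] B C' by auto
      then show False using n2 xy2 by blast
    qed
  qed
  then show ?thesis using cycle_free_iff[OF card] by blast
qed

text \<open>A bypass of an old edge that uses the new edge would, together with the old edge,
  connect \<open>x\<close> and \<open>w\<close> in \<open>S\<close>.\<close>

lemma cycle_free_insert:
  assumes card: "\<forall>e\<in>S. card e = 2" and xw: "\<not> conn S x w" and cf: "cycle_free S"
  shows "cycle_free (insert {x, w} S)"
proof -
  have "x \<noteq> w" using xw by auto
  then have card': "\<forall>e\<in>insert {x, w} S. card e = 2" using card by auto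
  note n = cf[unfolded cycle_free_iff[OF card]]
  have xwS: "{x, w} \<notin> S" using conn_edge[of x w S] xw by auto
  have "\<forall>p q. {p, q} \<in> insert {x, w} S \<longrightarrow> \<not> conn (insert {x, w} S - {{p, q}}) p q"
  proof (intro allI impI notI)
    fix p q assume pq: "{p, q} \<in> insert {x, w} S" and c: "conn (insert {x, w} S - {{p, q}}) p q"
    show False
    proof (cases "{p, q} = {x, w}")
      case True
      then have "conn S p q" using c xwS by simp
      then show False using True xw by (auto simp: doubleton_eq_iff intro: conn_sym)
    next
      case False
      then have pqS: "{p, q} \<in> S" using pq by simp
      have "insert {x, w} S - {{p, q}} = insert {x, w} (S - {{p, q}})" using False by auto
      then consider "conn (S - {{p, q}}) p q"
        | "conn (S - {{p, q}}) p x" "conn (S - {{p, q}}) w q"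
        | "conn (S - {{p, q}}) p w" "conn (S - {{p, q}}) x q"
        using conn_insert[of x w "S - {{p, q}}" p q] c by auto
      then show False
      proof cases
        case 1
        then show False using n pqS by blast
      next
        case 2
        then have "conn S p x" "conn S w q" by (auto intro: conn_mono)
        then have "conn S x w" using conn_edge[OF pqS] by (meson conn_sym conn_trans)
        then show False using xw by simp
      next
        case 3
        then have "conn S p w" "conn S x q" by (auto intro: conn_mono)
        then have "conn S x w" using conn_edge[OF pqS] by (meson conn_sym conn_trans)
        then show False using xw by simp
      qed
    qed
  qed
  then show ?thesis using cycle_free_iff[OF card'] by blast
qed

lemma cycle_free_empty: "cycle_free {}"
  by (simp add: cycle_free_iff)

lemma comp_edge:
  assumes "e \<in> A" "card e = 2"
  shows "e \<subseteq> {u. conn A x u} \<or> e \<inter> {u. conn A x u} = {}"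
proof -
  obtain p q where e: "e = {p, q}" using assms(2) by (auto simp: card_2_iff)
  have "conn A p q" "conn A q p" using assms(1) conn_edge[of p q A] conn_edge[of q p A] by (auto simp: e insert_commute)
  then have "conn A x p \<longleftrightarrow> conn A x q" by (meson conn_trans)
  then show ?thesis by (auto simp: e)
qed

lemma conn_comp:
  assumes "\<forall>e\<in>A. card e = 2" and "conn A x u"
  shows "conn (A \<inter> Pow {u. conn A x u}) x u"
proof -
  define C where "C = {u. conn A x u}"
  have "conn ((A \<inter> Pow C) \<union> (A - Pow C)) x u"
    using assms(2) by (simp add: Int_Diff_Un)
  then have "u \<in> C \<and> conn (A \<inter> Pow C) x u"
  proof (rule conn_within)
    show "x \<in> C" by (simp add: C_def)
    show "e \<inter> C = {}" if "e \<in> A - Pow C" for e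
      using comp_edge[of e A x, folded C_def] assms(1) that by blast
    show "e \<subseteq> C" if "e \<in> A \<inter> Pow C" for e using that by simp
  qed
  then show ?thesis by (simp add: C_def)
qed

text \<open>\<open>w\<close> is the vertex following the last visit to \<open>x\<close>, so the rest
  of the walk does not use the edge \<open>{x, w}\<close>.\<close>

lemma conn_first_edge:
  assumes "conn A x z" "x \<noteq> z"
  shows "\<exists>w. {x, w} \<in> A \<and> conn (A - {{x, w}}) w z"
proof -
  have "z = x \<or> (\<exists>w. {x, w} \<in> A \<and> conn (A - {{x, w}}) w z)"
    using assms(1)
  proof (induction rule: conn_induct)
    case (step y z)
    show ?case
    proof (cases "y = x")
      case True
      then show ?thesis using step.hyps(2) by (intro disjI2 exI[of _ z]) simp
    next
      case yx: False
      show ?thesis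
      proof (cases "z = x")
        case False
        obtain w where w: "{x, w} \<in> A" "conn (A - {{x, w}}) w y" using step.IH yx by auto
        have "{y, z} \<in> A - {{x, w}}" using step.hyps(2) yx False by (auto simp: doubleton_eq_iff)
        then have "conn (A - {{x, w}}) w z" using conn_trans[OF w(2) conn_edge] by simp
        then show ?thesis using w(1) by auto
      qed simp
    qed
  qed simp
  then show ?thesis using assms(2) by auto
qed

section \<open>Decomposition of the trees and forests of induced subgraphs\<close>

locale simple_edges =
  fixes E :: "'a set set"
  assumes card_E: "\<forall>e\<in>E. card e = 2"
begin

text \<open>The edge set is fixed while the vertex set varies, because \<open>tree_weights\<close>
  refers to the tree counts of all induced subgraphs.\<close>

definition inside :: "'a set \<Rightarrow> 'a set set" where
  "inside M = {e \<in> E. e \<subseteq> M}"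

definition tree_sets :: "'a set \<Rightarrow> 'a set set set" where
  "tree_sets M = spanning_trees (M, inside M)"

definition forest_sets :: "'a set \<Rightarrow> 'a set set set" where
  "forest_sets M = spanning_forests (M, inside M)"

lemma edge_card: "e \<in> E \<Longrightarrow> card e = 2"
  using card_E by blast

lemma no_small_edges: "{} \<notin> E" "{x} \<notin> E"
  using edge_card[of "{}"] edge_card[of "{x}"] by auto

lemma inside_small: "inside {} = {}" "inside {v} = {}"
  using no_small_edges by (auto simp: inside_def subset_singleton_iff)

lemma tree_sets_iff: "A \<in> tree_sets M \<longleftrightarrow> A \<subseteq> inside M \<and> M \<noteq> {} \<and> (\<forall>u\<in>M. \<forall>v\<in>M. conn A u v) \<and> cycle_free A"
  by (auto simp: tree_sets_def spanning_trees_def connected_graph_def conn_def)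

lemma tree_sets_inside: "A \<in> tree_sets M \<Longrightarrow> A \<subseteq> inside M"
  by (simp add: tree_sets_iff)

lemma forest_sets_iff: "A \<in> forest_sets M \<longleftrightarrow> A \<subseteq> inside M \<and> cycle_free A"
  by (auto simp: forest_sets_def spanning_forests_def)

lemma inside_subset: "A \<subseteq> inside M \<Longrightarrow> e \<in> A \<Longrightarrow> e \<subseteq> M"
  by (auto simp: inside_def)

lemma finite_forest_sets:
  assumes "finite M"
  shows "finite (forest_sets M)"
proof -
  have "finite (inside M)"
    by (rule finite_subset[of _ "Pow M"]) (use assms in \<open>auto simp: inside_def\<close>)
  moreover have "forest_sets M \<subseteq> Pow (inside M)" by (auto simp: forest_sets_iff)
  ultimately show ?thesis by (meson finite_Pow_iff finite_subset)
qed

lemma finite_tree_sets: "finite M \<Longrightarrow> finite (tree_sets M)"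
  by (rule finite_subset[OF _ finite_forest_sets[of M]]) (auto simp: forest_sets_iff tree_sets_iff)

lemma card_inside: "A \<subseteq> inside M \<Longrightarrow> \<forall>e\<in>A. card e = 2"
  using card_E by (auto simp: inside_def)

lemma conn_stay:
  assumes "A \<subseteq> inside M" "u \<in> M" "conn A u v"
  shows "v \<in> M"
  using conn_within[of A "{}" u v M] assms by (auto simp: inside_def)

lemma split_union:
  assumes "A1 \<subseteq> inside B" "A2 \<subseteq> inside C" "B \<inter> C = {}"
  shows "A1 = (A1 \<union> A2) \<inter> Pow B" "A2 = (A1 \<union> A2) - Pow B"
proof -
  have "e \<notin> Pow B" if "e \<in> A2" for e
  proof
    assume "e \<in> Pow B"
    then have "e = {}" using inside_subset[OF assms(2) that] assms(3) by blast
    then show False using card_inside[OF assms(2)] that by auto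
  qed
  then show "A1 = (A1 \<union> A2) \<inter> Pow B" "A2 = (A1 \<union> A2) - Pow B"
    using assms by (auto simp: inside_def)
qed

lemma inside_disjoint:
  assumes "A \<subseteq> inside C" "B \<inter> C = {}" "e \<in> A"
  shows "e \<inter> B = {}"
  using inside_subset[OF assms(1,3)] assms(2) by blast

text \<open>Recovers \<open>B\<close> from the union as the component of \<open>r\<close>; with
  \<open>split_union\<close> this makes the decompositions injective.\<close>

lemma comp_union:
  assumes A1: "A1 \<in> tree_sets B" and A2: "A2 \<subseteq> inside C" and BC: "B \<inter> C = {}" and r: "r \<in> B"
  shows "{u. conn (A1 \<union> A2) r u} = B"
proof
  have A1': "A1 \<subseteq> inside B" using A1 by (simp add: tree_sets_iff)
  show "{u. conn (A1 \<union> A2) r u} \<subseteq> B"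
    using conn_within[OF _ r inside_subset[OF A1'] inside_disjoint[OF A2 BC]] by blast
  show "B \<subseteq> {u. conn (A1 \<union> A2) r u}"
    using A1 r by (auto simp: tree_sets_iff intro: conn_mono)
qed

lemma cycle_free_union':
  assumes A1: "A1 \<subseteq> inside B" and A2: "A2 \<subseteq> inside C" and BC: "B \<inter> C = {}"
    and cf: "cycle_free A1" "cycle_free A2"
  shows "cycle_free (A1 \<union> A2)"
proof (rule cycle_free_union[OF _ inside_subset[OF A1] inside_disjoint[OF A2 BC] cf])
  show "\<forall>e\<in>A1 \<union> A2. card e = 2" using card_inside[OF A1] card_inside[OF A2] by blast
qed

text \<open>Cutting along the component of \<open>x\<close> provides the preimages that make the
  decompositions surjective.\<close>

lemma split_comp:
  assumes A: "A \<subseteq> inside M" and x: "x \<in> M"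
  defines "C \<equiv> {u. conn A x u}"
  shows "C \<subseteq> M" "A \<inter> Pow C \<subseteq> inside C" "A - Pow C \<subseteq> inside (M - C)"
    and "u \<in> C \<Longrightarrow> v \<in> C \<Longrightarrow> conn (A \<inter> Pow C) u v"
proof -
  show "C \<subseteq> M" using conn_stay[OF A x] by (auto simp: C_def)
  show "A \<inter> Pow C \<subseteq> inside C" using A by (auto simp: inside_def)
  show "A - Pow C \<subseteq> inside (M - C)"
    using comp_edge[of _ A x, folded C_def] card_inside[OF A] A by (auto simp: inside_def)
  show "conn (A \<inter> Pow C) u v" if "u \<in> C" "v \<in> C"
    using conn_comp[OF card_inside[OF A], of x, folded C_def] that
    by (metis C_def conn_sym conn_trans mem_Collect_eq)
qed

text \<open>A forest corresponds to the component \<open>C\<close> of \<open>r\<close>, a tree on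
  \<open>C\<close> and a forest on the remaining vertices.\<close>

lemma card_forest_sets_root:
  assumes U: "finite U" and r: "r \<in> U"
  shows "card (forest_sets U) = (\<Sum>C\<in>{C \<in> Pow U. r \<in> C}. card (tree_sets C) * card (forest_sets (U - C)))"
proof -
  define D where "D = (SIGMA C:{C \<in> Pow U. r \<in> C}. tree_sets C \<times> forest_sets (U - C))"
  define \<phi> where "\<phi> = (\<lambda>(C :: 'a set, A1, A2). A1 \<union> A2 :: 'a set set)"
  have "inj_on \<phi> D"
  proof (rule inj_onI)
    fix p q assume p: "p \<in> D" and q: "q \<in> D" and eq: "\<phi> p = \<phi> q"
    obtain B A1 A2 where pe: "p = (B, A1, A2)" by (cases p)
    obtain B' A1' A2' where qe: "q = (B', A1', A2')" by (cases q)
    have a: "r \<in> B" "A1 \<in> tree_sets B" "A2 \<subseteq> inside (U - B)" "B \<inter> (U - B) = {}" "A1 \<subseteq> inside B"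
      using p by (auto simp: pe D_def forest_sets_iff tree_sets_inside)
    have b: "r \<in> B'" "A1' \<in> tree_sets B'" "A2' \<subseteq> inside (U - B')" "B' \<inter> (U - B') = {}" "A1' \<subseteq> inside B'"
      using q by (auto simp: qe D_def forest_sets_iff tree_sets_inside)
    have eq': "A1 \<union> A2 = A1' \<union> A2'" using eq by (simp add: \<phi>_def pe qe)
    have "B = B'"
      using comp_union[OF a(2,3,4,1)] comp_union[OF b(2,3,4,1)] eq' by simp
    then show "p = q"
      using split_union[OF a(5,3,4)] split_union[OF b(5,3,4)] eq' by (simp add: pe qe)
  qed
  moreover have "\<phi> ` D = forest_sets U"
  proof
    show "\<phi> ` D \<subseteq> forest_sets U"
    proof
      fix A assume "A \<in> \<phi> ` D"
      then obtain C A1 A2 where C: "C \<subseteq> U" "A1 \<in> tree_sets C" "A2 \<in> forest_sets (U - C)" "A = A1 \<union> A2"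
        by (auto simp: D_def \<phi>_def)
      have "cycle_free (A1 \<union> A2)"
        by (rule cycle_free_union'[of A1 C A2 "U - C"]) (use C(2,3) in \<open>simp_all add: tree_sets_iff forest_sets_iff\<close>)
      moreover have "A1 \<union> A2 \<subseteq> inside U"
        using tree_sets_inside[OF C(2)] C(1,3) unfolding forest_sets_iff inside_def by blast
      ultimately show "A \<in> forest_sets U" by (simp add: forest_sets_iff C(4))
    qed
    show "forest_sets U \<subseteq> \<phi> ` D"
    proof
      fix A assume "A \<in> forest_sets U"
      then have A: "A \<subseteq> inside U" "cycle_free A" by (auto simp: forest_sets_iff)
      define C where "C = {u. conn A r u}"
      note s = split_comp[OF A(1) r, folded C_def]
      have rC: "r \<in> C" by (simp add: C_def)
      have "A \<inter> Pow C \<in> tree_sets C"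
        unfolding tree_sets_iff using s(2,4) rC cycle_free_subset[OF A(2), of "A \<inter> Pow C"] by blast
      moreover have "A - Pow C \<in> forest_sets (U - C)"
        unfolding forest_sets_iff using s(3) cycle_free_subset[OF A(2), of "A - Pow C"] by blast
      ultimately have "(C, A \<inter> Pow C, A - Pow C) \<in> D" using s(1) rC by (auto simp: D_def)
      moreover have "\<phi> (C, A \<inter> Pow C, A - Pow C) = A" by (auto simp: \<phi>_def)
      ultimately show "A \<in> \<phi> ` D" by (metis image_eqI)
    qed
  qed
  ultimately have "card (forest_sets U) = card D" by (metis card_image)
  also have "\<dots> = (\<Sum>C\<in>{C \<in> Pow U. r \<in> C}. card (tree_sets C \<times> forest_sets (U - C)))"
    unfolding D_def
    by (rule card_SigmaI) (use U finite_subset[OF _ U] in \<open>auto intro!: finite_cartesian_product finite_tree_sets finite_forest_sets\<close>)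
  finally show ?thesis by (simp add: card_cartesian_product)
qed

text \<open>A tree corresponds to the edge \<open>{x, w}\<close> on its path from \<open>x\<close>
  to \<open>z\<close> and the trees on the two sides left by removing that edge; \<open>B\<close> is
  the side of \<open>z\<close>.\<close>

lemma card_tree_sets_branch:
  assumes M: "finite M" and x: "x \<in> M" and z: "z \<in> M" and xz: "x \<noteq> z"
  shows "card (tree_sets M) = (\<Sum>B\<in>{B \<in> Pow M. z \<in> B \<and> x \<notin> B}. card {w \<in> B. {x, w} \<in> E} * (card (tree_sets B) * card (tree_sets (M - B))))"
proof -
  define D where "D = (SIGMA B:{B \<in> Pow M. z \<in> B \<and> x \<notin> B}. {w \<in> B. {x, w} \<in> E} \<times> (tree_sets B \<times> tree_sets (M - B)))"
  define \<phi> where "\<phi> = (\<lambda>(B :: 'a set, w, A1, A2). insert {x, w} (A1 \<union> A2))"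
  have "inj_on \<phi> D"
  proof (rule inj_onI)
    fix p q assume p: "p \<in> D" and q: "q \<in> D" and eq: "\<phi> p = \<phi> q"
    obtain B w A1 A2 where pe: "p = (B, w, A1, A2)" by (cases p)
    obtain B' w' A1' A2' where qe: "q = (B', w', A1', A2')" by (cases q)
    have a: "w \<in> B" "A1 \<in> tree_sets B" "A2 \<subseteq> inside (M - B)" "B \<inter> (M - B) = {}" "A1 \<subseteq> inside B" "z \<in> B" "x \<notin> B"
      using p by (auto simp: pe D_def tree_sets_inside)
    have b: "w' \<in> B'" "A1' \<in> tree_sets B'" "A2' \<subseteq> inside (M - B')" "B' \<inter> (M - B') = {}" "A1' \<subseteq> inside B'" "z \<in> B'" "x \<notin> B'"
      using q by (auto simp: qe D_def tree_sets_inside)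
    have eq': "insert {x, w} (A1 \<union> A2) = insert {x, w'} (A1' \<union> A2')" using eq by (simp add: \<phi>_def pe qe)
    have new: "{x, w} \<notin> A1 \<union> A2" "{x, w'} \<notin> A1' \<union> A2'"
      using inside_subset[OF a(3)] inside_subset[OF a(5)] inside_subset[OF b(3)] inside_subset[OF b(5)] a(1,7) b(1,7) by blast+
    \<comment> \<open>If \<open>w\<close> and \<open>w'\<close> differed, the edge
      \<open>{x, w'}\<close> would belong to \<open>A2\<close>, placing \<open>w'\<close> outside
      \<open>B\<close>. But \<open>A1'\<close> connects \<open>z\<close> to \<open>w'\<close> inside
      \<open>A1 \<union> A2\<close>, where the component of \<open>z\<close> is
      \<open>B\<close>.\<close>
    have w: "w = w'"
    proof (rule ccontr)
      assume "w \<noteq> w'"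
      then have "{x, w'} \<noteq> {x, w}" by (auto simp: doubleton_eq_iff)
      moreover have "{x, w'} \<in> insert {x, w} (A1 \<union> A2)" unfolding eq' by simp
      ultimately have "{x, w'} \<in> A1 \<union> A2" by simp
      moreover have "{x, w'} \<notin> A1" using inside_subset[OF a(5)] a(7) by blast
      ultimately have "{x, w'} \<in> A2" by simp
      then have w': "w' \<notin> B" using inside_subset[OF a(3)] by blast
      have "A1' \<subseteq> A1 \<union> A2"
      proof
        fix e assume e: "e \<in> A1'"
        then have "e \<noteq> {x, w}" using inside_subset[OF b(5) e] b(7) by blast
        moreover have "e \<in> insert {x, w} (A1 \<union> A2)" unfolding eq' using e by simp
        ultimately show "e \<in> A1 \<union> A2" by simp
      qed
      moreover have "conn A1' z w'" using b(1,2,6) by (simp add: tree_sets_iff)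
      ultimately have "conn (A1 \<union> A2) z w'" by (rule conn_mono[rotated])
      then have "w' \<in> B" using comp_union[OF a(2,3,4,6)] by auto
      then show False using w' by simp
    qed
    have eq2: "A1 \<union> A2 = A1' \<union> A2'" using insert_ident[OF new[folded w]] eq'[folded w] by blast
    have "B = B'"
      using comp_union[OF a(2,3,4,6)] comp_union[OF b(2,3,4,6)] eq2 by simp
    then show "p = q"
      using split_union[OF a(5,3,4)] split_union[OF b(5,3,4)] eq2 w unfolding pe qe by metis
  qed
  moreover have "\<phi> ` D = tree_sets M"
  proof
    show "\<phi> ` D \<subseteq> tree_sets M"
    proof
      fix A assume "A \<in> \<phi> ` D"
      then obtain B w A1 A2 where B: "B \<subseteq> M" "z \<in> B" "x \<notin> B" "w \<in> B" "{x, w} \<in> E"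
        "A1 \<in> tree_sets B" "A2 \<in> tree_sets (M - B)" "A = insert {x, w} (A1 \<union> A2)"
        by (auto simp: D_def \<phi>_def)
      have sub: "A1 \<subseteq> inside B" "A2 \<subseteq> inside (M - B)" using B(6,7) by (simp_all add: tree_sets_inside)
      have "cycle_free (A1 \<union> A2)"
        by (rule cycle_free_union'[OF sub]) (use B(6,7) tree_sets_iff in blast)+
      moreover have "\<not> conn (A1 \<union> A2) x w"
      proof
        assume "conn (A1 \<union> A2) x w"
        then have "x \<in> {u. conn (A1 \<union> A2) w u}" using conn_sym[of "A1 \<union> A2" x w] by simp
        then show False using comp_union[OF B(6) sub(2) _ B(4)] B(3) by simp
      qed
      moreover have "\<forall>e\<in>A1 \<union> A2. card e = 2"
        using card_inside[OF sub(1)] card_inside[OF sub(2)] by blast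
      ultimately have cf: "cycle_free A"
        unfolding B(8) by (intro cycle_free_insert)
      have AM: "A \<subseteq> inside M"
        unfolding B(8) using sub B(1,4,5) x by (auto simp: inside_def)
      have "conn A x u" if u: "u \<in> M" for u
      proof (cases "u \<in> B")
        case True
        then have "conn A1 w u" using B(4,6) by (simp add: tree_sets_iff)
        then have "conn A w u" by (rule conn_mono) (auto simp: B(8))
        moreover have "conn A x w" by (rule conn_edge) (simp add: B(8))
        ultimately show ?thesis by (rule conn_trans[rotated])
      next
        case False
        then have "conn A2 x u" using B(3,7) x u by (simp add: tree_sets_iff)
        then show ?thesis by (rule conn_mono) (auto simp: B(8))
      qed
      then have "conn A u v" if "u \<in> M" "v \<in> M" for u v
        using that conn_trans[OF conn_sym[of A x u], of v] by simp
      then show "A \<in> tree_sets M" unfolding tree_sets_iff using cf AM x by blast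
    qed
    show "tree_sets M \<subseteq> \<phi> ` D"
    proof
      fix A assume "A \<in> tree_sets M"
      then have A: "A \<subseteq> inside M" "cycle_free A" "\<And>u v. u \<in> M \<Longrightarrow> v \<in> M \<Longrightarrow> conn A u v"
        by (simp_all add: tree_sets_iff)
      obtain w where w: "{x, w} \<in> A" "conn (A - {{x, w}}) w z"
        using conn_first_edge[OF A(3)[OF x z] xz] by blast
      define S where "S = A - {{x, w}}"
      have S: "S \<subseteq> inside M" using A(1) by (auto simp: S_def)
      have wM: "w \<in> M" "{x, w} \<in> E" using w(1) A(1) by (auto simp: inside_def)
      define B where "B = {u. conn S w u}"
      note s = split_comp[OF S wM(1), folded B_def]
      have "\<not> conn S x w"
        using A(2) w(1) unfolding cycle_free_iff[OF card_inside[OF A(1)]] S_def by blast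
      then have xB: "x \<notin> B" using conn_sym[of S w x] by (auto simp: B_def)
      have zB: "z \<in> B" "w \<in> B" using w(2) by (auto simp: B_def S_def)
      have AS: "A = insert {x, w} S" using w(1) by (auto simp: S_def)
      have cfS: "cycle_free S" using cycle_free_subset[OF A(2)] by (simp add: S_def)
      have t1: "S \<inter> Pow B \<in> tree_sets B"
        unfolding tree_sets_iff using s(2,4) zB cycle_free_subset[OF cfS, of "S \<inter> Pow B"] by blast
      have disj: "(M - B) \<inter> B = {}" by blast
      have "conn (S - Pow B) x u" if u: "u \<in> M - B" for u
      proof -
        have "conn (insert {x, w} S) x u" using A(3)[of x u] x u by (simp add: AS)
        then have "conn S x u"
          using conn_insert[of x w S x u] u xB \<open>\<not> conn S x w\<close> by (auto simp: B_def)
        moreover have "(S - Pow B) \<union> (S \<inter> Pow B) = S" by (subst Un_commute) (rule Int_Diff_Un)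
        ultimately have "conn ((S - Pow B) \<union> (S \<inter> Pow B)) x u" by simp
        then show ?thesis
          using conn_within[OF _ _ inside_subset[OF s(3)] inside_disjoint[OF s(2) disj]] x xB by blast
      qed
      then have "conn (S - Pow B) u v" if "u \<in> M - B" "v \<in> M - B" for u v
        using that conn_trans[OF conn_sym[of "S - Pow B" x u], of v] by simp
      then have t2: "S - Pow B \<in> tree_sets (M - B)"
        unfolding tree_sets_iff using s(3) x xB cycle_free_subset[OF cfS, of "S - Pow B"] by blast
      have "(B, w, S \<inter> Pow B, S - Pow B) \<in> D"
        using s(1) zB xB wM t1 t2 by (auto simp: D_def)
      moreover have "\<phi> (B, w, S \<inter> Pow B, S - Pow B) = A"
        unfolding \<phi>_def AS by auto
      ultimately show "A \<in> \<phi> ` D" by (metis image_eqI)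
    qed
  qed
  ultimately have "card (tree_sets M) = card D" by (metis card_image)
  also have "\<dots> = (\<Sum>B\<in>{B \<in> Pow M. z \<in> B \<and> x \<notin> B}. card ({w \<in> B. {x, w} \<in> E} \<times> (tree_sets B \<times> tree_sets (M - B))))"
    unfolding D_def
    by (rule card_SigmaI) (use M finite_subset[OF _ M] in \<open>auto intro!: finite_cartesian_product finite_tree_sets\<close>)
  finally show ?thesis by (simp add: card_cartesian_product)
qed

sublocale tree_weights "\<lambda>x y. of_bool ({x, y} \<in> E)" "\<lambda>M. real (card (tree_sets M))"
proof
  show "of_bool ({x, x} \<in> E) = (0 :: real)" for x using no_small_edges(2)[of x] by simp
  show "of_bool ({x, y} \<in> E) = (of_bool ({y, x} \<in> E) :: real)" for x y by (simp add: insert_commute)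
  have "tree_sets {} = {}" by (auto simp: tree_sets_iff)
  then show "real (card (tree_sets {})) = 0" by simp
  show "real (card (tree_sets {v})) = 1" for v
  proof -
    have "tree_sets {v} = {{}}"
      using inside_small(2)[of v] cycle_free_empty by (auto simp: tree_sets_iff)
    then show ?thesis by simp
  qed
  show "real (card (tree_sets M)) = (\<Sum>B\<in>Pow M. of_bool (z \<in> B \<and> x \<notin> B) *
      ((\<Sum>w\<in>B. of_bool ({x, w} \<in> E)) * real (card (tree_sets B)) * real (card (tree_sets (M - B)))))"
    if "finite M" "x \<in> M" "z \<in> M" "x \<noteq> z" for M x z
  proof -
    have "real (card (tree_sets M)) = (\<Sum>B\<in>{B \<in> Pow M. z \<in> B \<and> x \<notin> B}.
        real (card {w \<in> B. {x, w} \<in> E}) * real (card (tree_sets B)) * real (card (tree_sets (M - B))))"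
      unfolding card_tree_sets_branch[OF that] by (simp add: mult.assoc)
    also have "\<dots> = (\<Sum>B\<in>Pow M. of_bool (z \<in> B \<and> x \<notin> B) *
      ((\<Sum>w\<in>B. of_bool ({x, w} \<in> E)) * real (card (tree_sets B)) * real (card (tree_sets (M - B)))))"
    proof (rule sum.mono_neutral_cong_left)
      fix B assume B: "B \<in> {B \<in> Pow M. z \<in> B \<and> x \<notin> B}"
      then have "finite B" using that(1) finite_subset by auto
      then have "(\<Sum>w\<in>B. of_bool ({x, w} \<in> E)) = real (card {w \<in> B. {x, w} \<in> E})"
        by (simp add: of_bool_def sum.If_cases Int_def)
      then show "real (card {w \<in> B. {x, w} \<in> E}) * real (card (tree_sets B)) * real (card (tree_sets (M - B))) =
        of_bool (z \<in> B \<and> x \<notin> B) * ((\<Sum>w\<in>B. of_bool ({x, w} \<in> E)) * real (card (tree_sets B)) * real (card (tree_sets (M - B))))"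
        using B by simp
    qed (use that in auto)
    finally show ?thesis .
  qed
qed auto

lemma forest_sets_root:
  assumes U: "finite U" and r: "r \<in> U"
  shows "real (card (forest_sets U)) = (\<Sum>C\<in>Pow U. of_bool (r \<in> C) * (real (card (tree_sets C)) * real (card (forest_sets (U - C)))))"
proof -
  have "real (card (forest_sets U)) = (\<Sum>C\<in>{C \<in> Pow U. r \<in> C}. real (card (tree_sets C)) * real (card (forest_sets (U - C))))"
    unfolding card_forest_sets_root[OF assms] by simp
  also have "\<dots> = (\<Sum>C\<in>Pow U. of_bool (r \<in> C) * (real (card (tree_sets C)) * real (card (forest_sets (U - C)))))"
    by (rule sum.mono_neutral_cong_left) (use U in auto)
  finally show ?thesis .
qed

lemma forest_sets_empty: "card (forest_sets {}) = 1"
proof -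
  have "forest_sets {} = {{}}" using inside_small(1) cycle_free_empty by (auto simp: forest_sets_iff)
  then show ?thesis by simp
qed

lemma forest_tree_ratio:
  assumes V: "finite V" "V \<noteq> {}"
  shows "ratio (card V) * real (card (tree_sets V)) \<le> real (card (forest_sets V))"
    and "complete_on V \<Longrightarrow> real (card (forest_sets V)) = ratio (card V) * real (card (tree_sets V))"
    and "\<lbrakk>card (tree_sets V) > 0; x \<in> V; y \<in> V; x \<noteq> y; {x, y} \<notin> E\<rbrakk> \<Longrightarrow>
      ratio (card V) * real (card (tree_sets V)) < real (card (forest_sets V))"
proof -
  have root: "real (card (forest_sets U)) = (\<Sum>C\<in>Pow U. of_bool (r \<in> C) * (real (card (tree_sets C)) * real (card (forest_sets (U - C)))))"
    if "U \<subseteq> V" "r \<in> U" for U r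
    by (rule forest_sets_root[OF finite_subset[OF that(1) V(1)] that(2)])
  note main = forests_trees_ratio[of V "\<lambda>U. real (card (forest_sets U))", OF V _ root]
  show "ratio (card V) * real (card (tree_sets V)) \<le> real (card (forest_sets V))"
    using main(1) forest_sets_empty by simp
  show "complete_on V \<Longrightarrow> real (card (forest_sets V)) = ratio (card V) * real (card (tree_sets V))"
    using main(2) forest_sets_empty by simp
  show "\<lbrakk>card (tree_sets V) > 0; x \<in> V; y \<in> V; x \<noteq> y; {x, y} \<notin> E\<rbrakk> \<Longrightarrow>
      ratio (card V) * real (card (tree_sets V)) < real (card (forest_sets V))"
    using main(3)[of x y] forest_sets_empty by simp
qed

text \<open>A connecting edge set of least size is acyclic, since an edge that is not a bridge could
  be dropped.\<close>

lemma tree_sets_pos: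
  assumes "finite V" "connected_graph (V, E)" "\<And>e. e \<in> E \<Longrightarrow> e \<subseteq> V"
  shows "card (tree_sets V) > 0"
proof -
  have fE: "finite E" by (rule finite_subset[of _ "Pow V"]) (use assms(1,3) in auto)
  define P where "P A \<longleftrightarrow> A \<subseteq> E \<and> (\<forall>u\<in>V. \<forall>v\<in>V. conn A u v)" for A
  have "P E" using assms(2) by (simp add: P_def connected_graph_def conn_def)
  then obtain A where A: "P A" "\<And>A'. P A' \<Longrightarrow> card A \<le> card A'"
    using ex_has_least_nat[of P E card] by blast
  have AE: "A \<subseteq> E" using A(1) by (simp add: P_def)
  then have fA: "finite A" using fE by (rule finite_subset)
  have c: "\<forall>e\<in>A. card e = 2" using AE card_E by blast
  have "cycle_free A"
    unfolding cycle_free_iff[OF c]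
  proof (intro allI impI notI)
    fix x y assume xy: "{x, y} \<in> A" and con: "conn (A - {{x, y}}) x y"
    have "P (A - {{x, y}})"
      unfolding P_def
    proof (intro conjI ballI)
      show "A - {{x, y}} \<subseteq> E" using AE by blast
      fix u v assume "u \<in> V" "v \<in> V"
      then have "conn (insert {x, y} (A - {{x, y}})) u v"
        using A(1) xy by (auto simp: P_def insert_absorb)
      then show "conn (A - {{x, y}}) u v"
        using conn_insert[of x y "A - {{x, y}}" u v] con conn_sym[OF con] conn_trans[of "A - {{x, y}}"] by metis
    qed
    then have "card A \<le> card (A - {{x, y}})" by (rule A(2))
    then show False using card_Diff1_less[OF fA xy] by simp
  qed
  moreover have "A \<subseteq> inside V" using AE assms(3) by (auto simp: inside_def)
  ultimately have "A \<in> tree_sets V"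
    using A(1) assms(2) by (auto simp: tree_sets_iff P_def connected_graph_def)
  then show ?thesis using finite_tree_sets[OF assms(1)] by (auto simp: card_gt_0_iff)
qed

end

section \<open>Comparison with the complete graph\<close>

theorem theorem1p2:
  fixes G :: "'a graph" and n :: nat
  assumes "n \<ge> 1"
    and "simple_graph G"
    and "connected_graph G"
    and "card (vertices G) = n"
  shows "real (num_spanning_forests G) / real (num_spanning_trees G)
           \<ge> real (num_spanning_forests (K_graph n)) / real (num_spanning_trees (K_graph n))
       \<and> (real (num_spanning_forests G) / real (num_spanning_trees G)
           = real (num_spanning_forests (K_graph n)) / real (num_spanning_trees (K_graph n))
          \<longleftrightarrow> G = complete_graph (vertices G))"
proof -
  obtain V E where G: "G = (V, E)" by (cases G)
  have V: "finite V" "V \<noteq> {}" "card V = n" and E: "\<forall>e\<in>E. e \<subseteq> V \<and> card e = 2" and conV: "connected_graph (V, E)"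
    using assms by (auto simp: G simple_graph_def connected_graph_def)
  interpret G: simple_edges E using E by unfold_locales auto
  have "G.inside V = E" using E by (auto simp: G.inside_def)
  then have G_eq: "num_spanning_forests G = card (G.forest_sets V)" "num_spanning_trees G = card (G.tree_sets V)"
    by (simp_all add: G num_spanning_forests_def num_spanning_trees_def G.forest_sets_def G.tree_sets_def)
  \<comment> \<open>Positive tree counts, here and for \<open>K_graph n\<close>, rule out the
    default value of division by zero.\<close>
  have posG: "card (G.tree_sets V) > 0"
    by (rule G.tree_sets_pos) (use V E conV in auto)
  define EK where "EK = {e :: nat set. e \<subseteq> {..<n} \<and> card e = 2}"
  interpret K: simple_edges EK by unfold_locales (auto simp: EK_def)
  have K: "K_graph n = ({..<n}, EK)" by (simp add: K_graph_def complete_graph_def EK_def)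
  have "K.inside {..<n} = EK" unfolding K.inside_def by (auto simp: EK_def)
  then have K_eq: "num_spanning_forests (K_graph n) = card (K.forest_sets {..<n})" "num_spanning_trees (K_graph n) = card (K.tree_sets {..<n})"
    by (simp_all add: K num_spanning_forests_def num_spanning_trees_def K.forest_sets_def K.tree_sets_def)
  have ne: "{..<n} \<noteq> {}" using assms(1) by (auto simp: lessThan_empty_iff)
  have K_complete: "K.complete_on {..<n}" unfolding K.complete_on_def by (auto simp: EK_def)
  have "real (card (K.tree_sets {..<n})) > 0"
    using K.complete_pos[OF _ ne K_complete] by simp
  \<comment> \<open>The constant \<open>ratio n\<close> depends only on \<open>n\<close> and is
    attained by the complete graph, so it is identified without being evaluated.\<close>
  then have K_ratio: "real (card (K.forest_sets {..<n})) / real (card (K.tree_sets {..<n})) = ratio n"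
    using K.forest_tree_ratio(2)[OF _ ne K_complete] by (simp add: field_simps)
  have complete_iff: "G = complete_graph (vertices G) \<longleftrightarrow> (\<forall>x\<in>V. \<forall>y\<in>V. x \<noteq> y \<longrightarrow> {x, y} \<in> E)"
  proof
    assume "G = complete_graph (vertices G)"
    then have "E = {e. e \<subseteq> V \<and> card e = 2}" by (simp add: G complete_graph_def)
    then show "\<forall>x\<in>V. \<forall>y\<in>V. x \<noteq> y \<longrightarrow> {x, y} \<in> E" by auto
  next
    assume all: "\<forall>x\<in>V. \<forall>y\<in>V. x \<noteq> y \<longrightarrow> {x, y} \<in> E"
    have "{e. e \<subseteq> V \<and> card e = 2} \<subseteq> E"
      using all by (auto simp: card_2_iff)
    then show "G = complete_graph (vertices G)" using E by (auto simp: G complete_graph_def)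
  qed
  have ge: "ratio n \<le> real (card (G.forest_sets V)) / real (card (G.tree_sets V))"
    using G.forest_tree_ratio(1)[OF V(1,2)] posG V(3) by (simp add: field_simps)
  have "real (card (G.forest_sets V)) / real (card (G.tree_sets V)) = ratio n \<longleftrightarrow> G = complete_graph (vertices G)"
  proof
    assume eq: "real (card (G.forest_sets V)) / real (card (G.tree_sets V)) = ratio n"
    show "G = complete_graph (vertices G)"
    proof (rule ccontr)
      assume "\<not> ?thesis"
      then obtain x y where "x \<in> V" "y \<in> V" "x \<noteq> y" "{x, y} \<notin> E" using complete_iff by blast
      then have "ratio n * real (card (G.tree_sets V)) < real (card (G.forest_sets V))"
        using G.forest_tree_ratio(3)[OF V(1,2) posG] V(3) by auto
      then show False using eq posG by (simp add: field_simps)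
    qed
  next
    assume "G = complete_graph (vertices G)"
    then have "G.complete_on V" using complete_iff by (auto simp: G.complete_on_def)
    then show "real (card (G.forest_sets V)) / real (card (G.tree_sets V)) = ratio n"
      using G.forest_tree_ratio(2)[OF V(1,2)] posG V(3) by (simp add: field_simps)
  qed
  then show ?thesis
    unfolding G_eq K_eq K_ratio using ge by blast
qed

end
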